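(* Let $n,m$ be positive integers and let $W_1,\dots,W_m\in\mathrm{SU}(2)$. It is possible to construct a quantum circuit, without ancilla qubits (i.e. acting only on the $n$ control and $m$ target qubits), that implements the $n$-controlled, $m$-target $\mathrm{SU}(2)$ gate $C^n\bigotimes_{i=1}^m W_i$ using at most $12n+8m-14$ CNOT gates (together with single-qubit gates), with depth $\mathcal{O}(\log n+\log m)$.
   Context: Circuits are built from arbitrary single-qubit unitary gates and CNOT gates (between arbitrary pairs of qubits). The CNOT count is the number of CNOT gates used. The depth is the minimal number of layers into which the gates can be arranged so that gates in the same layer act on disjoint qubits. The bound $\mathcal{O}(\log n+\log m)$ is with an absolute constant (independent of the $W_i$) and is understood up to an additive constant, i.e. depth $\le C(1+\log n+\log m)$. The gate $C^n\bigotimes_{i=1}^m W_i$ has $n$ control qubits and $m$ target qubits: it applies $W_i$ to the $i$-th target for every $i=1,\dots,m$ if all $n$ controls are in state $|1\rangle$, and acts as the identity on the targets when some control is in the computational basis state $|0\rangle$. *)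

theory Defs
  imports
    "Jordan_Normal_Form.Determinant"
    "Jordan_Normal_Form.Schur_Decomposition"
begin

definition unitary_mat :: "nat \<Rightarrow> complex mat \<Rightarrow> bool" where
  "unitary_mat d U \<longleftrightarrow> U \<in> carrier_mat d d \<and> U * mat_adjoint U = 1\<^sub>m d \<and> mat_adjoint U * U = 1\<^sub>m d"

definition SU2 :: "complex mat set" where
  "SU2 = {U. unitary_mat 2 U \<and> det U = 1}"

text \<open>
  Operators on \<open>N\<close> qubits are matrices of dimension \<open>2 ^ N\<close>. The computational basis state with
  index \<open>j\<close> has qubit \<open>q < N\<close> in state 1 iff \<open>bit j q\<close>, so qubit 0 is the least
  significant binary digit of the index. Entry \<open>(i, j)\<close> is the amplitude of the state \<open>i\<close> in the
  image of the state \<open>j\<close>.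
\<close>

datatype gate =
    Single nat "complex mat"  \<comment> \<open>qubit, matrix\<close>
  | CNOT nat nat              \<comment> \<open>control, target\<close>

fun gate_qubits :: "gate \<Rightarrow> nat set" where
  "gate_qubits (Single q U) = {q}"
| "gate_qubits (CNOT c t) = {c, t}"

fun valid_gate :: "nat \<Rightarrow> gate \<Rightarrow> bool" where
  "valid_gate N (Single q U) \<longleftrightarrow> q < N \<and> unitary_mat 2 U"
| "valid_gate N (CNOT c t) \<longleftrightarrow> c < N \<and> t < N \<and> c \<noteq> t"

fun gate_mat :: "nat \<Rightarrow> gate \<Rightarrow> complex mat" where
  "gate_mat N (Single q U) = mat (2 ^ N) (2 ^ N) (\<lambda>(i, j).
     if \<forall>p<N. p \<noteq> q \<longrightarrow> bit i p = bit j p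
     then U $$ (of_bool (bit i q), of_bool (bit j q)) else 0)"
| "gate_mat N (CNOT c t) = mat (2 ^ N) (2 ^ N) (\<lambda>(i, j).
     if i = (if bit j c then flip_bit t j else j) then 1 else 0)"

text \<open>A circuit is the list of its gates in the order in which they are applied.\<close>

type_synonym circuit = "gate list"

definition valid_circuit :: "nat \<Rightarrow> circuit \<Rightarrow> bool" where
  "valid_circuit N gs \<longleftrightarrow> (\<forall>g\<in>set gs. valid_gate N g)"

fun circuit_mat :: "nat \<Rightarrow> circuit \<Rightarrow> complex mat" where
  "circuit_mat N [] = 1\<^sub>m (2 ^ N)"
| "circuit_mat N (g # gs) = circuit_mat N gs * gate_mat N g"

definition cnot_count :: "circuit \<Rightarrow> nat" where
  "cnot_count gs = length (filter (\<lambda>g. \<exists>c t. g = CNOT c t) gs)"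

text \<open>
  An arrangement of the gates into layers \<open>0, \<dots>, d - 1\<close>. Gates with a common qubit must be in
  different layers, and the layers, executed one after the other, must respect the order of such
  gates in the circuit; only gates on disjoint qubits may share a layer or be reordered.
\<close>

definition layering :: "circuit \<Rightarrow> nat \<Rightarrow> (nat \<Rightarrow> nat) \<Rightarrow> bool" where
  "layering gs d l \<longleftrightarrow>
     (\<forall>a<length gs. l a < d) \<and>
     (\<forall>b<length gs. \<forall>a<b. gate_qubits (gs ! a) \<inter> gate_qubits (gs ! b) \<noteq> {} \<longrightarrow> l a < l b)"

definition circuit_depth :: "circuit \<Rightarrow> nat" where
  "circuit_depth gs = (LEAST d. \<exists>l. layering gs d l)"

text \<open>
  The gate \<open>C\<^sup>n (W 0 \<otimes> \<dots> \<otimes> W (m - 1))\<close>: the controls are the qubits \<open>0, \<dots>, n - 1\<close>, and the target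
  of \<open>W k\<close> is the qubit \<open>n + k\<close>.
\<close>

definition controlled_tensor_mat :: "nat \<Rightarrow> nat \<Rightarrow> (nat \<Rightarrow> complex mat) \<Rightarrow> complex mat" where
  "controlled_tensor_mat n m W = mat (2 ^ (n + m)) (2 ^ (n + m)) (\<lambda>(i, j).
     if \<forall>q<n. bit j q
     then (if \<forall>q<n. bit i q
           then \<Prod>k<m. W k $$ (of_bool (bit i (n + k)), of_bool (bit j (n + k))) else 0)
     else (if i = j then 1 else 0))"

end

theory Submission
  imports Defs
begin

text \<open>
  Write \<open>W k = V k * D k * V k\<^sup>\<dagger>\<close> with \<open>D k\<close> diagonal of determinant 1, and let \<open>R k\<close> be diagonal with
  \<open>R k ^ (-4) = D k\<close>. Conjugation by \<open>X\<close> inverts \<open>R k\<close>. So if two circuits apply \<open>X\<close> to all targets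
  under conditions \<open>F\<close> and \<open>G\<close> on the controls, their commutator, interleaved with the layers \<open>R\<close> and
  \<open>R\<^sup>\<dagger>\<close>, applies \<open>D k\<close> on the targets if \<open>F \<and> G\<close>, and nothing otherwise. Phases of the two circuits
  cancel, because each of them also occurs inverted.

  For \<open>G\<close> we take the conjunction of (at most) four controls, itself built from commutators. The
  condition \<open>F\<close> has to be the conjunction of the other controls only when \<open>G\<close> holds. The four
  qubits of \<open>G\<close> may thus be assumed to be in state 1 and serve as ancillas, and so does every pair of
  controls whose conjunction has been written to an ancilla, as long as this conjunction is 1. The
  number of available ancillas grows from 4 to 6 to 10 in two rounds of bounded depth, so that the
  remaining controls can be split into two halves with four ancillas each: the depth is
  logarithmic, and each control costs one relative-phase Toffoli gate (3 CNOTs) per direction.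
  Fan-out to the targets is a balanced tree of CNOTs.
\<close>

section \<open>Circuits acting on amplitude functions\<close>

text \<open>A basis state is a truth assignment to all qubits, so no dimension enters and gates
  compose as plain functions. The value at \<open>s\<close> is the amplitude of \<open>s\<close>
  after the gate. A \<open>CNOT\<close> with distinct qubits is an involution, so the state read is
  also the image of \<open>s\<close>.\<close>

fun gate_app :: "gate \<Rightarrow> ((nat \<Rightarrow> bool) \<Rightarrow> complex) \<Rightarrow> (nat \<Rightarrow> bool) \<Rightarrow> complex" where
  "gate_app (Single q U) \<psi> s = U $$ (of_bool (s q), 0) * \<psi> (s(q := False))
     + U $$ (of_bool (s q), 1) * \<psi> (s(q := True))"
| "gate_app (CNOT c t) \<psi> s = \<psi> (s(t := (s t \<noteq> s c)))"

definition sem :: "circuit \<Rightarrow> ((nat \<Rightarrow> bool) \<Rightarrow> complex) \<Rightarrow> (nat \<Rightarrow> bool) \<Rightarrow> complex" where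
  "sem gs = fold gate_app gs"

lemma sem_Nil [simp]: "sem [] \<psi> = \<psi>"
  and sem_Cons: "sem (g # gs) \<psi> = sem gs (gate_app g \<psi>)"
  and sem_append: "sem (gs @ hs) \<psi> = sem hs (sem gs \<psi>)"
  by (simp_all add: sem_def)

lemma sem_single [simp]: "sem [g] \<psi> = gate_app g \<psi>"
  by (simp add: sem_def)

definition cqubits :: "circuit \<Rightarrow> nat set" where
  "cqubits gs = (\<Union>g\<in>set gs. gate_qubits g)"

lemma cqubits_simps [simp]:
  "cqubits [] = {}" "cqubits (g # gs) = gate_qubits g \<union> cqubits gs"
  "cqubits (gs @ hs) = cqubits gs \<union> cqubits hs" "cqubits (rev gs) = cqubits gs"
  by (auto simp: cqubits_def)

lemma valid_circuit_simps [simp]: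
  "valid_circuit N []" "valid_circuit N (g # gs) \<longleftrightarrow> valid_gate N g \<and> valid_circuit N gs"
  "valid_circuit N (gs @ hs) \<longleftrightarrow> valid_circuit N gs \<and> valid_circuit N hs"
  by (auto simp: valid_circuit_def)

section \<open>Agreement of amplitude functions with the matrix semantics\<close>

lemma bit_below_power: "(i::nat) < 2 ^ N \<Longrightarrow> bit i q \<Longrightarrow> q < N"
  by (metis bit_take_bit_iff take_bit_nat_eq_self)

lemma less_power_if_bits: "(\<And>q. bit (i::nat) q \<Longrightarrow> q < N) \<Longrightarrow> i < 2 ^ N"
  by (metis bit_eqI bit_take_bit_iff take_bit_nat_less_exp)

lemma bit_eq_fun_iff: "bit (i::nat) = bit j \<longleftrightarrow> i = j"
  by (metis bit_eq_iff)

lemma bit_flip_bit_fun: "bit (flip_bit q (i::nat)) = (bit i)(q := \<not> bit i q)"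
  by (auto simp: bit_flip_bit_iff fun_eq_iff)

lemma bit_set_bit_fun: "bit (set_bit q (i::nat)) = (bit i)(q := True)"
  by (auto simp: bit_set_bit_iff fun_eq_iff)

lemma bit_unset_bit_fun: "bit (unset_bit q (i::nat)) = (bit i)(q := False)"
  by (auto simp: bit_unset_bit_iff fun_eq_iff)

lemmas bit_fun = bit_flip_bit_fun bit_set_bit_fun bit_unset_bit_fun

lemma bit_op_less:
  assumes "(i::nat) < 2 ^ N" "q < N"
  shows "flip_bit q i < 2 ^ N" "set_bit q i < 2 ^ N" "unset_bit q i < 2 ^ N"
  using assms by (auto intro!: less_power_if_bits simp: bit_fun split: if_splits dest: bit_below_power)

abbreviation amp_vec :: "nat \<Rightarrow> ((nat \<Rightarrow> bool) \<Rightarrow> complex) \<Rightarrow> complex vec" where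
  "amp_vec N \<psi> \<equiv> vec (2 ^ N) (\<lambda>i. \<psi> (bit i))"

text \<open>Row \<open>i\<close> of a gate matrix is supported on the indices obtained from
  \<open>i\<close> by changing one bit: at most two for a single-qubit gate, one for a
  \<open>CNOT\<close>. The matrix-vector sum collapses to these terms.\<close>

lemma gate_mat_mult_amp_vec:
  assumes "valid_gate N g"
  shows "gate_mat N g *\<^sub>v amp_vec N \<psi> = amp_vec N (gate_app g \<psi>)"
proof (cases g)
  case (Single q U)
  with assms have q: "q < N" by simp
  show ?thesis
  proof (rule eq_vecI)
    fix i assume "i < dim_vec (amp_vec N (gate_app g \<psi>))"
    then have i: "i < 2 ^ N" by simp
    have ne: "unset_bit q i \<noteq> set_bit q i"
      by (metis bit_set_bit_fun bit_unset_bit_fun fun_upd_same)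
    have *: "(\<forall>p<N. p \<noteq> q \<longrightarrow> bit i p = bit j p) \<longleftrightarrow> j \<in> {unset_bit q i, set_bit q i}"
      if "j < 2 ^ N" for j
    proof
      assume L: "\<forall>p<N. p \<noteq> q \<longrightarrow> bit i p = bit j p"
      \<comment> \<open>Both indices are below \<open>2 ^ N\<close>, so their bits from position
        \<open>N\<close> on vanish and agreement below \<open>N\<close> is agreement
        everywhere.\<close>
      have "bit j = (bit i)(q := bit j q)"
        using L i that bit_below_power[OF i] bit_below_power[OF that] by (auto simp: fun_eq_iff)
      then show "j \<in> {unset_bit q i, set_bit q i}"
        by (metis bit_eq_fun_iff bit_set_bit_fun bit_unset_bit_fun insertCI)
    qed (auto simp: bit_fun)
    have "(gate_mat N g *\<^sub>v amp_vec N \<psi>) $ i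
      = (\<Sum>j<2^N. if j \<in> {unset_bit q i, set_bit q i}
           then U $$ (of_bool (bit i q), of_bool (bit j q)) * \<psi> (bit j) else 0)"
      using i by (auto simp: Single scalar_prod_def atLeast0LessThan * intro!: sum.cong)
    also have "\<dots> = (\<Sum>j\<in>{unset_bit q i, set_bit q i}. 
           U $$ (of_bool (bit i q), of_bool (bit j q)) * \<psi> (bit j))"
      using bit_op_less[OF i q] by (intro sum.mono_neutral_cong_right) auto
    also have "\<dots> = gate_app g \<psi> (bit i)"
      using ne by (simp add: Single bit_fun)
    finally show "(gate_mat N g *\<^sub>v amp_vec N \<psi>) $ i = amp_vec N (gate_app g \<psi>) $ i"
      using i by simp
  qed (simp add: Single)
next
  case (CNOT c t)
  with assms have ct: "c < N" "t < N" "c \<noteq> t" by auto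
  show ?thesis
  proof (rule eq_vecI)
    fix i assume "i < dim_vec (amp_vec N (gate_app g \<psi>))"
    then have i: "i < 2 ^ N" by simp
    let ?k = "if bit i c then flip_bit t i else i"
    have *: "i = (if bit j c then flip_bit t j else j) \<longleftrightarrow> j = ?k" for j
      using ct by (auto simp: bit_eq_fun_iff[symmetric] bit_fun)
    have "(gate_mat N g *\<^sub>v amp_vec N \<psi>) $ i = (\<Sum>j<2^N. if j = ?k then \<psi> (bit j) else 0)"
      unfolding CNOT using i
      by (simp add: scalar_prod_def atLeast0LessThan * if_distrib[of "\<lambda>x. x * _"] cong: if_cong)
    also have "\<dots> = \<psi> (bit ?k)"
      using bit_op_less(1)[OF i ct(2)] i by (subst sum.delta) auto
    also have "\<dots> = gate_app g \<psi> (bit i)"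
      by (auto simp: CNOT bit_fun intro!: arg_cong[of _ _ \<psi>])
    finally show "(gate_mat N g *\<^sub>v amp_vec N \<psi>) $ i = amp_vec N (gate_app g \<psi>) $ i"
      using i by simp
  qed (simp add: CNOT)
qed

lemma gate_mat_carrier [simp]: "gate_mat N g \<in> carrier_mat (2 ^ N) (2 ^ N)"
  by (cases g) auto

lemma circuit_mat_carrier [simp]: "circuit_mat N gs \<in> carrier_mat (2 ^ N) (2 ^ N)"
  by (induction gs) (auto intro: mult_carrier_mat)

lemma circuit_mat_mult_amp_vec:
  "valid_circuit N gs \<Longrightarrow> circuit_mat N gs *\<^sub>v amp_vec N \<psi> = amp_vec N (sem gs \<psi>)"
proof (induction gs arbitrary: \<psi>)
  case (Cons g gs)
  have "circuit_mat N (g # gs) *\<^sub>v amp_vec N \<psi>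
      = circuit_mat N gs *\<^sub>v (gate_mat N g *\<^sub>v amp_vec N \<psi>)"
    by (simp, rule assoc_mult_mat_vec[OF circuit_mat_carrier gate_mat_carrier]) simp
  with Cons show ?case by (simp add: gate_mat_mult_amp_vec sem_Cons)
qed (simp add: one_mult_mat_vec[of _ "2 ^ N"])

text \<open>The point mass at \<open>bit j\<close> corresponds to the unit vector \<open>j\<close>,
  which picks out column \<open>j\<close>.\<close>

lemma circuit_mat_index:
  assumes "valid_circuit N gs" "i < 2 ^ N" "j < 2 ^ N"
  shows "circuit_mat N gs $$ (i, j) = sem gs (\<lambda>s. of_bool (s = bit j)) (bit i)"
proof -
  have e: "amp_vec N (\<lambda>s. of_bool (s = bit j)) = unit_vec (2 ^ N) j"
    using assms by (intro eq_vecI) (auto simp: bit_eq_fun_iff unit_vec_def)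
  have "circuit_mat N gs $$ (i, j) = col (circuit_mat N gs) j $ i"
    using assms circuit_mat_carrier[of N gs] by (metis carrier_matD(1,2) index_col)
  also have "\<dots> = (circuit_mat N gs *\<^sub>v unit_vec (2 ^ N) j) $ i"
    using assms carrier_matD[OF circuit_mat_carrier[of N gs]]
    by (simp add: scalar_prod_right_unit)
  also have "\<dots> = sem gs (\<lambda>s. of_bool (s = bit j)) (bit i)"
    using assms circuit_mat_mult_amp_vec[OF assms(1), of  "\<lambda>s. of_bool (s = bit j)"] by (simp add: e)
  finally show ?thesis .
qed

section \<open>Two-by-two matrices with explicit entries\<close>

definition mat2 :: "complex \<Rightarrow> complex \<Rightarrow> complex \<Rightarrow> complex \<Rightarrow> complex mat" where
  "mat2 a b c d = mat 2 2 (\<lambda>(i, j). if i = 0 then if j = 0 then a else b else if j = 0 then c else d)"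

lemma mat2_carrier [simp]: "mat2 a b c d \<in> carrier_mat 2 2"
  and mat2_dim [simp]: "dim_row (mat2 a b c d) = 2" "dim_col (mat2 a b c d) = 2"
  by (auto simp: mat2_def)

lemma mat2_index [simp]:
  "mat2 a b c d $$ (0, 0) = a" "mat2 a b c d $$ (0, Suc 0) = b"
  "mat2 a b c d $$ (Suc 0, 0) = c" "mat2 a b c d $$ (Suc 0, Suc 0) = d"
  by (auto simp: mat2_def)

lemma mat2_eta:
  "U \<in> carrier_mat 2 2 \<Longrightarrow> U = mat2 (U $$ (0, 0)) (U $$ (0, 1)) (U $$ (1, 0)) (U $$ (1, 1))"
  by (rule eq_matI) (auto simp: less_2_cases_iff)

lemma mat2_cases:
  assumes "U \<in> carrier_mat 2 2"
  obtains a b c d where "U = mat2 a b c d"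
  using mat2_eta[OF assms] by blast

lemma mat2_eq_iff: "mat2 a b c d = mat2 a' b' c' d' \<longleftrightarrow> a = a' \<and> b = b' \<and> c = c' \<and> d = d'"
  by (metis mat2_index)

lemma sum_upto_2: "(\<Sum>i = 0..<2. f i) = f 0 + f (Suc 0)"
  by (simp add: numeral_2_eq_2)

lemma mat2_mult:
  "mat2 a b c d * mat2 a' b' c' d'
   = mat2 (a * a' + b * c') (a * b' + b * d') (c * a' + d * c') (c * b' + d * d')"
  by (rule eq_matI) (auto simp: scalar_prod_def sum_upto_2 less_2_cases_iff)

lemma mat2_adjoint: "mat_adjoint (mat2 a b c d) = mat2 (cnj a) (cnj c) (cnj b) (cnj d)"
  by (rule eq_matI) (auto simp: mat_adjoint_def mat_of_rows_def less_2_cases_iff)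

lemma mat2_one: "1\<^sub>m 2 = mat2 1 0 0 1"
  by (rule eq_matI) (auto simp: less_2_cases_iff)

lemmas mat2_simps = mat2_mult mat2_adjoint mat2_one mat2_eq_iff

lemma unitary_mat_carrier: "unitary_mat d U \<Longrightarrow> U \<in> carrier_mat d d"
  by (simp add: unitary_mat_def)

lemma unitary_mat2:
  "unitary_mat 2 (mat2 a b c d) \<longleftrightarrow>
   mat2 a b c d * mat_adjoint (mat2 a b c d) = 1\<^sub>m 2 \<and> mat_adjoint (mat2 a b c d) * mat2 a b c d = 1\<^sub>m 2"
  by (simp add: unitary_mat_def)

lemma mat2_adjoint_adjoint: "(U :: complex mat) \<in> carrier_mat 2 2 \<Longrightarrow> mat_adjoint (mat_adjoint U) = U"
  by (rule mat2_cases, assumption) (simp add: mat2_adjoint)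

lemma mat2_adjoint_carrier: "(U :: complex mat) \<in> carrier_mat 2 2 \<Longrightarrow> mat_adjoint U \<in> carrier_mat 2 2"
  by (rule mat2_cases, assumption) (simp add: mat2_adjoint)

lemma unitary_mat_adjoint: "unitary_mat 2 U \<Longrightarrow> unitary_mat 2 (mat_adjoint U)"
  by (auto simp: unitary_mat_def mat2_adjoint_adjoint mat2_adjoint_carrier)

lemma app_Single_True:
  "s q \<Longrightarrow> gate_app (Single q U) \<psi> s = U $$ (1, 0) * \<psi> (s(q := False)) + U $$ (1, 1) * \<psi> s"
  using fun_upd_triv[of s q] by simp

lemma app_Single_False:
  "\<not> s q \<Longrightarrow> gate_app (Single q U) \<psi> s = U $$ (0, 0) * \<psi> s + U $$ (0, 1) * \<psi> (s(q := True))"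
  using fun_upd_triv[of s q] by simp

lemma app_Single_mult:
  assumes "U \<in> carrier_mat 2 2" "V \<in> carrier_mat 2 2"
  shows "gate_app (Single q V) (gate_app (Single q U) \<psi>) = gate_app (Single q (V * U)) \<psi>"
proof
  fix s
  obtain a b c d where U: "U = mat2 a b c d" by (rule mat2_cases[OF assms(1)])
  obtain a' b' c' d' where V: "V = mat2 a' b' c' d'" by (rule mat2_cases[OF assms(2)])
  show "gate_app (Single q V) (gate_app (Single q U) \<psi>) s = gate_app (Single q (V * U)) \<psi> s"
    by (cases "s q") (simp_all add: U V mat2_mult algebra_simps)
qed

lemma app_Single_one [simp]: "gate_app (Single q (1\<^sub>m 2)) \<psi> = \<psi>"
proof
  fix s show "gate_app (Single q (1\<^sub>m 2)) \<psi> s = \<psi> s"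
    by (cases "s q") (simp_all add: app_Single_True app_Single_False mat2_one del: gate_app.simps)
qed

section \<open>Inverse circuits and commutation of disjoint circuits\<close>

fun gate_inv :: "gate \<Rightarrow> gate" where
  "gate_inv (Single q U) = Single q (mat_adjoint U)"
| "gate_inv (CNOT c t) = CNOT c t"

definition cinv :: "circuit \<Rightarrow> circuit" where
  "cinv gs = rev (map gate_inv gs)"

lemma cinv_simps [simp]:
  "cinv [] = []" "cinv (g # gs) = cinv gs @ [gate_inv g]" "cinv (gs @ hs) = cinv hs @ cinv gs"
  by (simp_all add: cinv_def)

lemma gate_qubits_inv [simp]: "gate_qubits (gate_inv g) = gate_qubits g"
  by (cases g) auto

lemma cqubits_cinv [simp]: "cqubits (cinv gs) = cqubits gs"
  by (induction gs) auto

lemma valid_gate_inv: "valid_gate N g \<Longrightarrow> valid_gate N (gate_inv g)"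
  by (cases g) (auto intro: unitary_mat_adjoint)

lemma valid_cinv [simp]: "valid_circuit N gs \<Longrightarrow> valid_circuit N (cinv gs)"
  by (induction gs) (auto intro: valid_gate_inv)

lemma cnot_count_simps [simp]:
  "cnot_count [] = 0" "cnot_count (Single q U # gs) = cnot_count gs"
  "cnot_count (CNOT c t # gs) = Suc (cnot_count gs)"
  "cnot_count (gs @ hs) = cnot_count gs + cnot_count hs"
  by (auto simp: cnot_count_def)

lemma cnot_count_cinv [simp]: "cnot_count (cinv gs) = cnot_count gs"
proof (induction gs)
  case (Cons g gs) then show ?case by (cases g) auto
qed simp

lemma app_gate_inv:
  assumes "valid_gate N g"
  shows "gate_app (gate_inv g) (gate_app g \<psi>) = \<psi> \<and> gate_app g (gate_app (gate_inv g) \<psi>) = \<psi>"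
proof (cases g)
  case (Single q U)
  with assms have "unitary_mat 2 U" by simp
  then have "gate_app (Single q (mat_adjoint U)) (gate_app (Single q U) \<psi>) = \<psi>"
    "gate_app (Single q U) (gate_app (Single q (mat_adjoint U)) \<psi>) = \<psi>"
    by (subst app_Single_mult; simp add: unitary_mat_def mat2_adjoint_carrier del: gate_app.simps)+
  then show ?thesis
    by (simp_all add: Single del: gate_app.simps)
next
  case (CNOT c t)
  with assms show ?thesis
    by (auto simp: fun_eq_iff intro!: arg_cong[of _ _ \<psi>])
qed

lemma sem_cinv [simp]:
  assumes "valid_circuit N gs"
  shows "sem (cinv gs) (sem gs \<psi>) = \<psi>" "sem gs (sem (cinv gs) \<psi>) = \<psi>"
proof -
  have "sem (cinv gs) (sem gs \<psi>) = \<psi> \<and> sem gs (sem (cinv gs) \<psi>) = \<psi>"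
    using assms
  proof (induction gs arbitrary: \<psi>)
    case (Cons g gs)
    then have "valid_gate N g" by simp
    note inv = app_gate_inv[OF this]
    show ?case using Cons inv by (simp add: sem_Cons sem_append)
  qed simp
  then show "sem (cinv gs) (sem gs \<psi>) = \<psi>" "sem gs (sem (cinv gs) \<psi>) = \<psi>" by auto
qed

lemma app_commute:
  assumes "gate_qubits g \<inter> gate_qubits h = {}"
  shows "gate_app g (gate_app h \<psi>) = gate_app h (gate_app g \<psi>)"
  using assms by (cases g; cases h) (auto simp: fun_eq_iff fun_upd_twist algebra_simps)

lemma sem_app_commute:
  "gate_qubits g \<inter> cqubits hs = {} \<Longrightarrow> sem hs (gate_app g \<psi>) = gate_app g (sem hs \<psi>)"
proof (induction hs arbitrary: \<psi>)
  case (Cons h hs)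
  then show ?case
    using app_commute[of h g \<psi>] by (simp add: sem_Cons Int_Un_distrib Int_commute)
qed simp

lemma sem_commute:
  "cqubits gs \<inter> cqubits hs = {} \<Longrightarrow> sem hs (sem gs \<psi>) = sem gs (sem hs \<psi>)"
  by (induction gs arbitrary: \<psi>) (auto simp: sem_Cons sem_app_commute Int_Un_distrib2)

section \<open>Circuits on the slice of states with fixed values outside a set of qubits\<close>

definition agree_off :: "nat set \<Rightarrow> (nat \<Rightarrow> bool) \<Rightarrow> (nat \<Rightarrow> bool) \<Rightarrow> bool" where
  "agree_off T s s' \<longleftrightarrow> (\<forall>q. q \<notin> T \<longrightarrow> s' q = s q)"

lemma agree_off_refl [simp]: "agree_off T s s"
  by (simp add: agree_off_def)

lemma agree_off_trans: "agree_off T s s' \<Longrightarrow> agree_off T s' s'' \<Longrightarrow> agree_off T s s''"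
  by (simp add: agree_off_def)

lemma app_local:
  assumes "\<And>s'. agree_off T s s' \<Longrightarrow> \<psi> s' = \<chi> s'" "gate_qubits g \<subseteq> T"
  shows "gate_app g \<psi> s = gate_app g \<chi> s"
proof (cases g)
  case (Single q U)
  then have "agree_off T s (s(q := b))" for b
    using assms(2) by (auto simp: agree_off_def)
  with assms(1) Single show ?thesis by simp
next
  case (CNOT c t)
  then have "agree_off T s (s(t := b))" for b
    using assms(2) by (auto simp: agree_off_def)
  with assms(1) CNOT show ?thesis by simp
qed

text \<open>Gates confined to \<open>T\<close> never leave the slice of states that agree with
  \<open>s\<close> outside \<open>T\<close>, so amplitudes elsewhere are invisible to them.\<close>

lemma sem_local:
  assumes "\<And>s'. agree_off T s s' \<Longrightarrow> \<psi> s' = \<chi> s'" "cqubits gs \<subseteq> T"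
  shows "sem gs \<psi> s = sem gs \<chi> s"
  using assms
proof (induction gs arbitrary: \<psi> \<chi>)
  case (Cons g gs)
  have "gate_app g \<psi> s' = gate_app g \<chi> s'" if "agree_off T s s'" for s'
    by (rule app_local[of T]) (use Cons.prems agree_off_trans[OF that] in \<open>simp_all\<close>)
  then show ?case
    using Cons.IH[of "gate_app g \<psi>" "gate_app g \<chi>"] Cons.prems(2) by (simp add: sem_Cons)
qed simp

text \<open>Two circuits coincide on the slice through \<open>s\<close>, for arbitrary input
  amplitudes. With the controls frozen in this way, a controlled operation can be compared with an
  uncontrolled one on the targets.\<close>

definition eqv :: "nat set \<Rightarrow> (nat \<Rightarrow> bool) \<Rightarrow> circuit \<Rightarrow> circuit \<Rightarrow> bool" where
  "eqv T s gs hs \<longleftrightarrow> (\<forall>\<psi> s'. agree_off T s s' \<longrightarrow> sem gs \<psi> s' = sem hs \<psi> s')"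

lemma eqv_refl [simp]: "eqv T s gs gs"
  by (simp add: eqv_def)

lemma eqv_trans: "eqv T s gs hs \<Longrightarrow> eqv T s hs ks \<Longrightarrow> eqv T s gs ks"
  by (simp add: eqv_def)

lemma eqv_sem: "(\<And>\<psi>. sem gs \<psi> = sem hs \<psi>) \<Longrightarrow> eqv T s gs hs"
  by (simp add: eqv_def)

text \<open>Only the replacement \<open>hs'\<close> has to stay inside \<open>T\<close>: once
  \<open>hs\<close> has been exchanged for it, only the slice values of the first parts matter. The
  original circuits may use controls outside \<open>T\<close>.\<close>

lemma eqv_append:
  assumes "eqv T s gs gs'" "eqv T s hs hs'" "cqubits hs' \<subseteq> T"
  shows "eqv T s (gs @ hs) (gs' @ hs')"
  unfolding eqv_def
proof (intro allI impI)
  fix \<psi> s' assume s': "agree_off T s s'"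
  have "sem hs' (sem gs \<psi>) s' = sem hs' (sem gs' \<psi>) s'"
    by (rule sem_local[of T]) (use assms agree_off_trans[OF s'] in \<open>simp_all add: eqv_def\<close>)
  then show "sem (gs @ hs) \<psi> s' = sem (gs' @ hs') \<psi> s'"
    using assms s' by (simp add: eqv_def sem_append)
qed

lemma eqv_cinv:
  assumes "eqv T s gs hs" "valid_circuit N gs" "valid_circuit N hs" "cqubits hs \<subseteq> T"
  shows "eqv T s (cinv gs) (cinv hs)"
  unfolding eqv_def
proof (intro allI impI)
  fix \<psi> s' assume s': "agree_off T s s'"
  define \<chi> where "\<chi> = sem (cinv gs) \<psi>"
  have "sem (cinv hs) \<psi> s' = sem (cinv hs) (sem gs \<chi>) s'"
    using assms by (simp add: \<chi>_def)
  also have "\<dots> = sem (cinv hs) (sem hs \<chi>) s'"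
    by (rule sem_local[of T]) (use assms agree_off_trans[OF s'] in \<open>simp_all add: eqv_def\<close>)
  finally show "sem (cinv gs) \<psi> s' = sem (cinv hs) \<psi> s'"
    using assms by (simp add: \<chi>_def)
qed

text \<open>Every state lies in its own \<open>T'\<close>-slice, so a claim for all these slices
  covers the whole \<open>T\<close>-slice. This widens one target to many.\<close>

lemma eqv_mono:
  assumes "\<And>s'. agree_off T s s' \<Longrightarrow> eqv T' s' gs hs"
  shows "eqv T s gs hs"
  using assms agree_off_refl unfolding eqv_def by meson

lemma eqv_CNOT:
  assumes "c \<notin> T"
  shows "eqv T s [CNOT c t] (if s c then [Single t (mat2 0 1 1 0)] else [])"
  using assms fun_upd_triv[of _ t] by (auto simp: eqv_def agree_off_def)

section \<open>Layers of single-qubit gates\<close>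

definition layer :: "(nat \<Rightarrow> complex mat) \<Rightarrow> nat list \<Rightarrow> circuit" where
  "layer f ts = map (\<lambda>t. Single t (f t)) ts"

lemma layer_simps [simp]:
  "layer f [] = []" "layer f (t # ts) = Single t (f t) # layer f ts"
  "layer f (ts @ us) = layer f ts @ layer f us"
  by (simp_all add: layer_def)

lemma cqubits_layer [simp]: "cqubits (layer f ts) = set ts"
  by (induction ts) auto

lemma cnot_count_layer [simp]: "cnot_count (layer f ts) = 0"
  by (induction ts) auto

lemma valid_layer: "(\<And>t. t \<in> set ts \<Longrightarrow> t < N \<and> unitary_mat 2 (f t)) \<Longrightarrow> valid_circuit N (layer f ts)"
  by (induction ts) auto

lemma layer_cong: "(\<And>t. t \<in> set ts \<Longrightarrow> f t = g t) \<Longrightarrow> layer f ts = layer g ts"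
  by (simp add: layer_def)

lemma sem_layer_mult:
  assumes "distinct ts" "\<And>t. t \<in> set ts \<Longrightarrow> f t \<in> carrier_mat 2 2 \<and> g t \<in> carrier_mat 2 2"
  shows "sem (layer g ts) (sem (layer f ts) \<psi>) = sem (layer (\<lambda>t. g t * f t) ts) \<psi>"
  using assms
proof (induction ts arbitrary: \<psi>)
  case (Cons t ts)
  then have "gate_app (Single t (g t)) (sem (layer f ts) (gate_app (Single t (f t)) \<psi>))
     = sem (layer f ts) (gate_app (Single t (g t * f t)) \<psi>)"
    by (subst sem_app_commute[symmetric]) (auto simp: app_Single_mult simp del: gate_app.simps)
  with Cons show ?case by (simp add: sem_Cons)
qed simp

lemma sem_layer_one:
  "(\<And>t. t \<in> set ts \<Longrightarrow> f t = 1\<^sub>m 2) \<Longrightarrow> sem (layer f ts) \<psi> = \<psi>"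
  by (induction ts arbitrary: \<psi>) (simp_all add: sem_Cons)

lemma sem_cinv_layer:
  assumes "distinct ts"
  shows "sem (cinv (layer f ts)) \<psi> = sem (layer (\<lambda>t. mat_adjoint (f t)) ts) \<psi>"
  using assms
proof (induction ts arbitrary: \<psi>)
  case (Cons t ts)
  then show ?case by (simp add: sem_append sem_Cons sem_app_commute del: gate_app.simps)
qed simp

section \<open>Upper bounds for the depth\<close>

definition fits :: "circuit \<Rightarrow> nat \<Rightarrow> bool" where
  "fits gs d \<longleftrightarrow> (\<exists>l. layering gs d l)"

text \<open>Bounds compose under \<open>fits\<close> without reference to minimality; the least
  depth is reached only through this inequality.\<close>

lemma circuit_depth_le: "fits gs d \<Longrightarrow> circuit_depth gs \<le> d"
  unfolding fits_def circuit_depth_def by (rule Least_le)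

lemma fits_mono: "fits gs d \<Longrightarrow> d \<le> d' \<Longrightarrow> fits gs d'"
  unfolding fits_def layering_def by (meson order_less_le_trans)

lemma fits_length: "fits gs (length gs)"
  unfolding fits_def layering_def by (rule exI[of _ id]) auto

lemma fits_Nil [simp]: "fits [] d"
  by (simp add: fits_def layering_def)

lemma fits_append:
  assumes "fits gs d" "fits hs e"
  shows "fits (gs @ hs) (d + e)"
proof -
  obtain l m where l: "layering gs d l" and m: "layering hs e m"
    using assms by (auto simp: fits_def)
  define k where "k a = (if a < length gs then l a else d + m (a - length gs))" for a
  have "layering (gs @ hs) (d + e) k"
    unfolding layering_def
  proof (intro conjI allI impI)
    fix a assume "a < length (gs @ hs)"
    then show "k a < d + e"
      using l m by (auto simp: k_def layering_def intro: trans_less_add1)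
  next
    fix b a assume b: "b < length (gs @ hs)" and a: "a < b"
      and q: "gate_qubits ((gs @ hs) ! a) \<inter> gate_qubits ((gs @ hs) ! b) \<noteq> {}"
    consider "b < length gs" | "a < length gs" "\<not> b < length gs" | "\<not> a < length gs" "\<not> b < length gs"
      by blast
    then show "k a < k b"
    proof cases
      case 1
      with l a q show ?thesis by (auto simp: k_def layering_def nth_append)
    next
      case 2
      with l show ?thesis by (auto simp: k_def layering_def intro: trans_less_add1)
    next
      case 3
      then have "a - length gs < b - length gs" "b - length gs < length hs" using a b by auto
      with m q 3 show ?thesis by (auto simp: k_def layering_def nth_append)
    qed
  qed
  then show ?thesis by (auto simp: fits_def)
qed

text \<open>Gates from different parts share no qubit, so the two layerings may be superimposed
  instead of stacked.\<close>

lemma fits_append_disjoint: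
  assumes "fits gs d" "fits hs d" and disj: "cqubits gs \<inter> cqubits hs = {}"
  shows "fits (gs @ hs) d"
proof -
  obtain l m where l: "layering gs d l" and m: "layering hs d m"
    using assms by (auto simp: fits_def)
  define k where "k a = (if a < length gs then l a else m (a - length gs))" for a
  have "layering (gs @ hs) d k"
    unfolding layering_def
  proof (intro conjI allI impI)
    fix a assume "a < length (gs @ hs)"
    then show "k a < d"
      using l m by (auto simp: k_def layering_def)
  next
    fix b a assume b: "b < length (gs @ hs)" and a: "a < b"
      and q: "gate_qubits ((gs @ hs) ! a) \<inter> gate_qubits ((gs @ hs) ! b) \<noteq> {}"
    consider "b < length gs" | "a < length gs" "\<not> b < length gs" | "\<not> a < length gs" "\<not> b < length gs"
      by blast
    then show "k a < k b"
    proof cases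
      case 1
      with l a q show ?thesis by (auto simp: k_def layering_def nth_append)
    next
      case 2
      with b have "gs ! a \<in> set gs" "hs ! (b - length gs) \<in> set hs" by auto
      then have "gate_qubits (gs ! a) \<subseteq> cqubits gs" "gate_qubits (hs ! (b - length gs)) \<subseteq> cqubits hs"
        unfolding cqubits_def by blast+
      with q 2 disj show ?thesis by (auto simp: nth_append)
    next
      case 3
      then have "a - length gs < b - length gs" "b - length gs < length hs" using a b by auto
      with m q 3 show ?thesis by (auto simp: k_def layering_def nth_append)
    qed
  qed
  then show ?thesis by (auto simp: fits_def)
qed

lemma fits_cinv:
  assumes "fits gs d"
  shows "fits (cinv gs) d"
proof -
  obtain l where l: "layering gs d l" using assms by (auto simp: fits_def)
  let ?n = "length gs"
  have len: "length (cinv gs) = ?n" by (simp add: cinv_def)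
  have nth: "gate_qubits (cinv gs ! a) = gate_qubits (gs ! (?n - Suc a))" if "a < ?n" for a
    using that by (simp add: cinv_def rev_nth)
  \<comment> \<open>Time reversal: positions are mirrored and layer \<open>x\<close> becomes layer
    \<open>d - 1 - x\<close>.\<close>
  have "layering (cinv gs) d (\<lambda>a. d - Suc (l (?n - Suc a)))"
    unfolding layering_def len
  proof (intro conjI allI impI)
    fix a assume "a < ?n"
    then have "l (?n - Suc a) < d" using l by (simp add: layering_def)
    then show "d - Suc (l (?n - Suc a)) < d" by simp
  next
    fix b a assume b: "b < ?n" and a: "a < b"
      and q: "gate_qubits (cinv gs ! a) \<inter> gate_qubits (cinv gs ! b) \<noteq> {}"
    have "?n - Suc a < ?n" "?n - Suc b < ?n - Suc a" using a b by auto
    then have "l (?n - Suc b) < l (?n - Suc a)" "l (?n - Suc a) < d"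
      using l q nth[of a] nth[of b] a b by (auto simp: layering_def Int_commute)
    then show "d - Suc (l (?n - Suc a)) < d - Suc (l (?n - Suc b))" by simp
  qed
  then show ?thesis by (auto simp: fits_def)
qed

lemma fits_layer: "distinct ts \<Longrightarrow> fits (layer f ts) 1"
proof (induction ts)
  case (Cons t ts)
  have "fits ([Single t (f t)] @ layer f ts) 1"
    by (rule fits_append_disjoint) (use Cons fits_length[of "[Single t (f t)]"] in auto)
  then show ?case by simp
qed simp

section \<open>Diagonalization in SU(2)\<close>

lemma mat2_det: "det (mat2 a b c d) = a * d - b * c"
proof -
  have "det (mat2 a b c d) = (\<Sum>j<2. mat2 a b c d $$ (0, j) * cofactor (mat2 a b c d) 0 j)"
    by (rule laplace_expansion_row[of _ 2]) auto
  also have "\<dots> = a * d - b * c"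
    by (simp add: cofactor_def numeral_2_eq_2 det_single[of _ ] mat_delete_def)
  finally show ?thesis .
qed

text \<open>Cramer's rule: \<open>(x, y)\<close> is the first row of a left inverse of the matrix
  with rows \<open>(a, c)\<close> and \<open>(b, d)\<close>, whose determinant is 1.\<close>

lemma unimodular_inverse_aux:
  fixes a b c d x y :: complex
  assumes "a * d - c * b = 1" "x * a + y * b = 1" "x * c + y * d = 0"
  shows "d = x" "c = - y"
proof -
  have "d * (x * a + y * b) = x * (a * d - c * b) + b * (x * c + y * d)" by (simp add: algebra_simps)
  then show "d = x" using assms by simp
  have "c * (x * a + y * b) = a * (x * c + y * d) - y * (a * d - c * b)" by (simp add: algebra_simps)
  then show "c = - y" using assms by simp
qed

lemma SU2_form:
  assumes "W \<in> SU2"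
  obtains a b where "W = mat2 a (- cnj b) b (cnj a)" "a * cnj a + b * cnj b = 1"
proof -
  have "unitary_mat 2 W" "det W = 1" using assms by (auto simp: SU2_def)
  then obtain a b c d where W: "W = mat2 a c b d" and u: "unitary_mat 2 (mat2 a c b d)"
    by (metis mat2_cases unitary_mat_carrier)
  have det: "a * d - c * b = 1" using \<open>det W = 1\<close> by (simp add: W mat2_det)
  have 1: "cnj a * a + cnj b * b = 1" and 2: "cnj a * c + cnj b * d = 0"
    using u by (auto simp: unitary_mat2 mat2_simps)
  show ?thesis
    using that[of a b] W 1 unimodular_inverse_aux[OF det 1 2] by (simp add: mult.commute)
qed

lemma unit_complex_iff: "z * cnj z = 1 \<longleftrightarrow> cmod z = 1"
  by (metis complex_norm_square norm_ge_zero of_real_1 of_real_eq_iff power2_eq_1_iff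
      abs_norm_cancel abs_1 power2_eq_iff_nonneg one_power2 zero_le_one)

text \<open>Below, \<open>w\<close> and the capital letters stand for the conjugates of \<open>v\<close>, \<open>a\<close>, \<open>b\<close> and \<open>d\<close>.\<close>

lemma eigenvector_aux:
  fixes a A b B d D v w k :: complex
  assumes "v = d - A" "w = D - a" "d * D = 1" "d + D = a + A" "a * A + b * B = 1"
    and "k * k * (v * w + b * B) = 1"
  shows "a = k * v * (d * (k * w) + 0 * (- k * b)) + - k * B * (0 * (k * w) + D * (- k * b))"
    "- B = k * v * (d * (k * B) + 0 * (k * v)) + - k * B * (0 * (k * B) + D * (k * v))"
    "b = k * b * (d * (k * w) + 0 * (- k * b)) + k * w * (0 * (k * w) + D * (- k * b))"
    "A = k * b * (d * (k * B) + 0 * (k * v)) + k * w * (0 * (k * B) + D * (k * v))"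
proof -
  have D: "D = a + A - d" using assms(4) by (simp add: algebra_simps)
  have w: "w = - v" unfolding assms(1,2) D by simp
  \<comment> \<open>The matrix and its diagonal form share the determinant 1 and the trace
    \<open>a + A\<close>. The equation derived from this says that \<open>(v, b)\<close> is an
    eigenvector for the eigenvalue \<open>d\<close>.\<close>
  have "b * B = d * (a + A - d) - a * A" using assms(3,5) unfolding D by (simp add: algebra_simps)
  then have bB: "b * B = (a - d) * v" unfolding assms(1) by (simp add: algebra_simps)
  have "v * w + b * B = v * (D - d)" unfolding w bB D assms(1) by (simp add: algebra_simps)
  \<comment> \<open>The squared norm of \<open>(v, b)\<close> factors, so this one scalar, equal to
    1, appears in all four entries.\<close>
  then have k: "k * k * (v * (D - d)) = 1" using assms(6) by simp
  have a: "(D - d) * a = d * w + D * (a - d)" unfolding assms(2) by (simp add: algebra_simps)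
  have A: "(D - d) * A = d * (a - d) + D * w" unfolding w assms(1) D by (simp add: algebra_simps)
  have "k * v * (d * (k * w) + 0 * (- k * b)) + - k * B * (0 * (k * w) + D * (- k * b))
      = k * k * (d * v * w + D * (b * B))" by (simp add: algebra_simps)
  also have "\<dots> = k * k * (v * (d * w + D * (a - d)))" unfolding bB by (simp add: algebra_simps)
  also have "\<dots> = (k * k * (v * (D - d))) * a" unfolding a[symmetric] by (simp add: mult.assoc)
  finally show "a = k * v * (d * (k * w) + 0 * (- k * b)) + - k * B * (0 * (k * w) + D * (- k * b))"
    by (simp add: k)
  have "k * v * (d * (k * B) + 0 * (k * v)) + - k * B * (0 * (k * B) + D * (k * v))
      = - (k * k * (v * (D - d))) * B" by (simp add: algebra_simps)
  then show "- B = k * v * (d * (k * B) + 0 * (k * v)) + - k * B * (0 * (k * B) + D * (k * v))"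
    by (simp add: k)
  have "k * b * (d * (k * w) + 0 * (- k * b)) + k * w * (0 * (k * w) + D * (- k * b))
      = (k * k * (v * (D - d))) * b" unfolding w by (simp add: algebra_simps)
  then show "b = k * b * (d * (k * w) + 0 * (- k * b)) + k * w * (0 * (k * w) + D * (- k * b))"
    by (simp add: k)
  have "k * b * (d * (k * B) + 0 * (k * v)) + k * w * (0 * (k * B) + D * (k * v))
      = k * k * (d * (b * B) + D * w * v)" by (simp add: algebra_simps)
  also have "\<dots> = k * k * (v * (d * (a - d) + D * w))" unfolding bB by (simp add: algebra_simps)
  also have "\<dots> = (k * k * (v * (D - d))) * A" unfolding A[symmetric] by (simp add: mult.assoc)
  finally show "A = k * b * (d * (k * B) + 0 * (k * v)) + k * w * (0 * (k * B) + D * (k * v))"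
    by (simp add: k)
qed

text \<open>The eigenvalues are conjugate points of the unit circle. They are written as fourth
  powers because the commutator applies the same rotation four times.\<close>

lemma SU2_diagonalization:
  assumes "W \<in> SU2"
  obtains V r where "unitary_mat 2 V" "r * cnj r = 1"
    "W = V * (mat2 (cnj r ^ 4) 0 0 (r ^ 4) * mat_adjoint V)"
proof -
  obtain a b where W: "W = mat2 a (- cnj b) b (cnj a)" and ab: "a * cnj a + b * cnj b = 1"
    using SU2_form[OF assms] .
  have root: "\<exists>r. r * cnj r = 1 \<and> cnj r ^ 4 = d" if "d * cnj d = 1" for d
  proof -
    have "cmod d = 1" using that unit_complex_iff by simp
    then have "d = cis (Arg d)" by (metis cis_Arg div_by_1 norm_zero of_real_1 sgn_div_norm scaleR_one inverse_1 zero_neq_one)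
    then show ?thesis
      by (intro exI[of _ "cis (- Arg d / 4)"]) (simp add: cis_cnj cis_mult DeMoivre)
  qed
  show ?thesis
  \<comment> \<open>For \<open>b = 0\<close> the matrix is already diagonal, and the eigenvector
    \<open>(v, b)\<close> used in the other case might vanish.\<close>
  proof (cases "b = 0")
    case True
    with ab obtain r where r: "r * cnj r = 1" "cnj r ^ 4 = a" using root[of a] by auto
    then have "r ^ 4 = cnj a" by (metis complex_cnj_cnj complex_cnj_power)
    with r True show ?thesis
      by (intro that[of "1\<^sub>m 2" r]) (simp_all add: W mat2_simps unitary_mat2 unitary_mat_def)
  next
    case False
    define c where "c = Re a"
    have "a * cnj a = of_real ((Re a)\<^sup>2 + (Im a)\<^sup>2)" by (simp add: complex_mult_cnj)
    moreover have "b * cnj b = of_real ((cmod b)\<^sup>2)" by (simp add: complex_norm_square del: of_real_power)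
    ultimately have "(Re a)\<^sup>2 + (Im a)\<^sup>2 + (cmod b)\<^sup>2 = 1"
      using ab by (metis of_real_add of_real_1 of_real_eq_iff)
    then have c: "c\<^sup>2 \<le> 1" unfolding c_def by (smt (verit) zero_le_power2)
    \<comment> \<open>The eigenvalue is the point of the unit circle whose real part is half the
      trace.\<close>
    define d where "d = Complex c (sqrt (1 - c\<^sup>2))"
    have d: "d * cnj d = 1" "d + cnj d = a + cnj a"
      using c by (simp_all add: d_def c_def complex_eq_iff power2_eq_square[symmetric])
    obtain r where r: "r * cnj r = 1" "cnj r ^ 4 = d" using root[OF d(1)] by blast
    have r': "r ^ 4 = cnj d" using r(2) by (metis complex_cnj_cnj complex_cnj_power)
    define v where "v = d - cnj a"
    define k where "k = complex_of_real (inverse (sqrt ((cmod v)\<^sup>2 + (cmod b)\<^sup>2)))"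
    have pos: "(cmod v)\<^sup>2 + (cmod b)\<^sup>2 > 0" using False by (simp add: add_nonneg_pos)
    have "k * k = of_real (inverse ((cmod v)\<^sup>2 + (cmod b)\<^sup>2))"
      using pos by (simp add: k_def flip: of_real_mult inverse_mult_distrib)
    moreover have "complex_of_real ((cmod v)\<^sup>2 + (cmod b)\<^sup>2) \<noteq> 0"
      using pos by (metis of_real_eq_0_iff less_irrefl)
    ultimately have kk: "k * k * (v * cnj v + b * cnj b) = 1"
      by (simp add: complex_norm_square[symmetric] del: of_real_power flip: of_real_add)
    have ck: "cnj k = k" by (simp add: k_def)
    have cv: "cnj v = cnj d - a" by (simp add: v_def)
    define V where "V = mat2 (k * v) (- k * cnj b) (k * b) (k * cnj v)"
    have "unitary_mat 2 V"
      using kk by (simp add: V_def unitary_mat2 mat2_simps ck algebra_simps)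
    moreover have "W = V * (mat2 (cnj r ^ 4) 0 0 (r ^ 4) * mat_adjoint V)"
      unfolding r r' W V_def mat2_simps complex_cnj_mult complex_cnj_minus complex_cnj_cnj ck
      by (intro conjI eigenvector_aux[OF v_def cv d ab kk])
    ultimately show ?thesis using that r(1) by blast
  qed
qed

section \<open>The commutator circuit\<close>

text \<open>The phase \<open>l\<close> is carried along because conjunctions obtained from
  commutators realise the NOT gate only up to a phase.\<close>

definition X_mat :: "complex \<Rightarrow> complex mat" where
  "X_mat l = mat2 0 l l 0"

lemma X_mat_carrier [simp]: "X_mat l \<in> carrier_mat 2 2"
  by (simp add: X_mat_def)

lemma X_mat_adjoint: "mat_adjoint (X_mat l) = X_mat (cnj l)"
  by (simp add: X_mat_def mat2_adjoint)

lemma unitary_X_mat: "l * cnj l = 1 \<Longrightarrow> unitary_mat 2 (X_mat l)"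
  by (simp add: X_mat_def unitary_mat2 mat2_simps mult.commute)

lemma eqv_layer_append:
  assumes "eqv (set ts) s gs (layer f ts)" "eqv (set ts) s hs (layer g ts)" "distinct ts"
    and "\<And>t. t \<in> set ts \<Longrightarrow> f t \<in> carrier_mat 2 2" "\<And>t. t \<in> set ts \<Longrightarrow> g t \<in> carrier_mat 2 2"
  shows "eqv (set ts) s (gs @ hs) (layer (\<lambda>t. g t * f t) ts)"
proof (rule eqv_trans)
  show "eqv (set ts) s (gs @ hs) (layer f ts @ layer g ts)"
    using assms by (intro eqv_append) auto
  show "eqv (set ts) s (layer f ts @ layer g ts) (layer (\<lambda>t. g t * f t) ts)"
    using assms by (intro eqv_sem) (simp add: sem_append sem_layer_mult)
qed

lemma eqv_layer_cinv:
  assumes "eqv (set ts) s gs (layer f ts)" "distinct ts" "valid_circuit N gs" "valid_circuit N (layer f ts)"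
  shows "eqv (set ts) s (cinv gs) (layer (\<lambda>t. mat_adjoint (f t)) ts)"
  by (rule eqv_trans[OF eqv_cinv[OF assms(1,3,4)]]) (auto intro!: eqv_sem simp: sem_cinv_layer assms)

text \<open>The condition is evaluated at the base point \<open>s\<close> and governs its whole
  slice, so for nonempty \<open>ts\<close> it can depend only on qubits outside
  \<open>ts\<close>.\<close>

definition X_if :: "nat \<Rightarrow> ((nat \<Rightarrow> bool) \<Rightarrow> bool) \<Rightarrow> (nat \<Rightarrow> complex) \<Rightarrow> nat list \<Rightarrow> circuit \<Rightarrow> bool" where
  "X_if N F l ts gs \<longleftrightarrow> valid_circuit N gs \<and> (\<forall>t\<in>set ts. l t * cnj (l t) = 1) \<and>
     (\<forall>s. eqv (set ts) s gs (layer (\<lambda>t. if F s then X_mat (l t) else 1\<^sub>m 2) ts))"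

lemma unitary_one: "unitary_mat 2 (1\<^sub>m 2)"
  by (simp add: mat2_one unitary_mat2 mat2_simps)

definition rot :: "complex \<Rightarrow> complex mat" where
  "rot r = mat2 r 0 0 (cnj r)"

lemma rot_carrier [simp]: "rot r \<in> carrier_mat 2 2"
  by (simp add: rot_def)

lemma unitary_rot: "r * cnj r = 1 \<Longrightarrow> unitary_mat 2 (rot r)"
  by (simp add: rot_def unitary_mat2 mat2_simps mult.commute)

text \<open>If \<open>F\<close> or \<open>G\<close> fails, neighbouring rotations cancel and the
  remaining factors cancel after them. If both hold, conjugation by \<open>X\<close> turns
  \<open>rot r\<close> into its inverse, so four copies of \<open>rot (cnj r)\<close> accumulate.
  The phases \<open>l\<close> and \<open>k\<close> meet their conjugates.\<close>

lemma commutator_matrix: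
  fixes F G :: bool
  assumes "r * cnj r = 1" "l * cnj l = 1" "k * cnj k = 1"
  defines "A \<equiv> \<lambda>z. if F then X_mat z else 1\<^sub>m 2" and "B \<equiv> \<lambda>z. if G then X_mat z else 1\<^sub>m 2"
  shows "rot (cnj r) * (B (cnj k) * (rot r * (A (cnj l) * (rot (cnj r) * (B k * (rot r * A l))))))
    = (if F \<and> G then mat2 (cnj r ^ 4) 0 0 (r ^ 4) else 1\<^sub>m 2)"
proof -
  have nz: "r \<noteq> 0" "l \<noteq> 0" "k \<noteq> 0" using assms(1-3) by auto
  then have inv: "cnj r = 1 / r" "cnj l = 1 / l" "cnj k = 1 / k"
    using assms(1-3) by (simp_all add: field_simps)
  have rot: "rot r = mat2 r 0 0 (1 / r)" "rot (1 / r) = mat2 (1 / r) 0 0 r"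
    using nz by (simp_all add: rot_def inv)
  show ?thesis
    unfolding A_def B_def inv rot
    by (cases F; cases G) (simp_all add: X_mat_def mat2_simps nz power4_eq_xxxx)
qed


lemma mat2_mult_carrier: "U \<in> carrier_mat 2 2 \<Longrightarrow> V \<in> carrier_mat 2 2 \<Longrightarrow> U * V \<in> carrier_mat 2 2"
  by simp

text \<open>The basis changes \<open>V\<close> need no control, since they cancel each other when
  the condition fails. Each of \<open>A\<close> and \<open>B\<close> occurs once directly and once
  inverted. The same construction later serves for small conjunctions.\<close>

lemma commutator_circuit:
  assumes ts: "distinct ts" "\<And>t. t \<in> set ts \<Longrightarrow> t < N"
    and W: "\<And>t. t \<in> set ts \<Longrightarrow> W t \<in> SU2"
    and A: "X_if N F l ts A" and B: "X_if N G k ts B"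
    and fits: "fits A dA" "fits B dB"
  obtains gs where "valid_circuit N gs"
    "\<And>s. eqv (set ts) s gs (layer (\<lambda>t. if F s \<and> G s then W t else 1\<^sub>m 2) ts)"
    "cnot_count gs = 2 * (cnot_count A + cnot_count B)" "fits gs (6 + 2 * (dA + dB))"
    "cqubits gs = set ts \<union> cqubits A \<union> cqubits B"
proof -
  have "\<forall>t\<in>set ts. \<exists>p. unitary_mat 2 (fst p) \<and> snd p * cnj (snd p) = 1 \<and>
      W t = fst p * (mat2 (cnj (snd p) ^ 4) 0 0 (snd p ^ 4) * mat_adjoint (fst p))"
    using SU2_diagonalization W by (metis fst_conv snd_conv)
  then obtain p where p: "\<And>t. t \<in> set ts \<Longrightarrow> unitary_mat 2 (fst (p t)) \<and> snd (p t) * cnj (snd (p t)) = 1 \<and>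
      W t = fst (p t) * (mat2 (cnj (snd (p t)) ^ 4) 0 0 (snd (p t) ^ 4) * mat_adjoint (fst (p t)))"
    by metis
  define V where "V t = fst (p t)" for t
  define r where "r t = snd (p t)" for t
  have V: "unitary_mat 2 (V t)" and r: "r t * cnj (r t) = 1"
    and WV: "W t = V t * (mat2 (cnj (r t) ^ 4) 0 0 (r t ^ 4) * mat_adjoint (V t))"
    if "t \<in> set ts" for t
    using p[OF that] by (auto simp: V_def r_def)
  have l: "l t * cnj (l t) = 1" and k: "k t * cnj (k t) = 1" if "t \<in> set ts" for t
    using A B that by (auto simp: X_if_def)
  have valid: "valid_circuit N A" "valid_circuit N B"
    using A B by (auto simp: X_if_def)
  define a where "a s = (\<lambda>t. if F s then X_mat (l t) else 1\<^sub>m 2)" for s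
  define b where "b s = (\<lambda>t. if G s then X_mat (k t) else 1\<^sub>m 2)" for s
  define a' where "a' s = (\<lambda>t. if F s then X_mat (cnj (l t)) else 1\<^sub>m 2)" for s
  define b' where "b' s = (\<lambda>t. if G s then X_mat (cnj (k t)) else 1\<^sub>m 2)" for s
  have one: "mat_adjoint (1\<^sub>m 2) = (1\<^sub>m 2 :: complex mat)" by (simp add: mat2_simps)
  have adj: "(\<lambda>t. mat_adjoint (a s t)) = a' s" "(\<lambda>t. mat_adjoint (b s t)) = b' s" for s
    by (auto simp: a_def b_def a'_def b'_def X_mat_adjoint one)
  have eA: "eqv (set ts) s A (layer (a s) ts)" and eB: "eqv (set ts) s B (layer (b s) ts)" for s
    using A B by (auto simp: X_if_def a_def b_def)
  have vA: "valid_circuit N (layer (a s) ts)" and vB: "valid_circuit N (layer (b s) ts)" for s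
    using l k ts by (auto intro!: valid_layer simp: a_def b_def unitary_X_mat unitary_one)
  have eA': "eqv (set ts) s (cinv A) (layer (a' s) ts)" for s
    using eqv_layer_cinv[OF eA ts(1) valid(1) vA] by (simp add: adj)
  have eB': "eqv (set ts) s (cinv B) (layer (b' s) ts)" for s
    using eqv_layer_cinv[OF eB ts(1) valid(2) vB] by (simp add: adj)
  have car: "a s t \<in> carrier_mat 2 2" "b s t \<in> carrier_mat 2 2" "a' s t \<in> carrier_mat 2 2" "b' s t \<in> carrier_mat 2 2" for s t
    by (auto simp: a_def b_def a'_def b'_def)
  have carV: "V t \<in> carrier_mat 2 2" "mat_adjoint (V t) \<in> carrier_mat 2 2" if "t \<in> set ts" for t
    using V[OF that] unitary_mat_carrier unitary_mat_adjoint by blast+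
  let ?R = "layer (\<lambda>t. rot (r t)) ts" and ?R' = "layer (\<lambda>t. rot (cnj (r t))) ts"
  define M where "M = A @ ?R @ B @ ?R' @ cinv A @ ?R @ cinv B @ ?R'"
  define K where "K s t = (if F s \<and> G s then mat2 (cnj (r t) ^ 4) 0 0 (r t ^ 4) else 1\<^sub>m 2)" for s t
  have carK: "K s t \<in> carrier_mat 2 2" for s t by (simp add: K_def)
  have eM: "eqv (set ts) s M (layer (K s) ts)" for s
  proof -
    \<comment> \<open>Bracketing to the left matches \<open>eqv_layer_append\<close>, which puts one
      new matrix factor in front per appended block.\<close>
    have "eqv (set ts) s (((((((A @ ?R) @ B) @ ?R') @ cinv A) @ ?R) @ cinv B) @ ?R')
      (layer (\<lambda>t. rot (cnj (r t)) * (b' s t * (rot (r t) * (a' s t * (rot (cnj (r t)) * (b s t * (rot (r t) * a s t))))))) ts)"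
      by (intro eqv_layer_append eqv_refl eA eB eA' eB' ts(1) mat2_mult_carrier car rot_carrier)
    moreover have "layer (\<lambda>t. rot (cnj (r t)) * (b' s t * (rot (r t) * (a' s t * (rot (cnj (r t)) * (b s t * (rot (r t) * a s t))))))) ts
      = layer (K s) ts"
      by (intro layer_cong) (simp add: K_def a_def b_def a'_def b'_def commutator_matrix r l k)
    ultimately show ?thesis by (simp add: M_def)
  qed
  define gs where "gs = layer (\<lambda>t. mat_adjoint (V t)) ts @ M @ layer V ts"
  show ?thesis
  proof (rule that[of gs])
    have "valid_circuit N (layer (\<lambda>t. mat_adjoint (V t)) ts)" "valid_circuit N (layer V ts)"
      "valid_circuit N ?R" "valid_circuit N ?R'"
      using V r ts by (auto intro!: valid_layer unitary_mat_adjoint unitary_rot simp: mult.commute)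
    then show "valid_circuit N gs" using valid by (simp add: gs_def M_def)
    show "cnot_count gs = 2 * (cnot_count A + cnot_count B)"
      by (simp add: gs_def M_def)
    show "cqubits gs = set ts \<union> cqubits A \<union> cqubits B"
      by (auto simp: gs_def M_def)
    \<comment> \<open>The six single-qubit layers are two basis changes and four rotations.\<close>
    have "fits gs (1 + ((dA + (1 + (dB + (1 + (dA + (1 + (dB + 1))))))) + 1))"
      unfolding gs_def M_def using ts(1) fits by (intro fits_append fits_layer fits_cinv)
    then show "fits gs (6 + 2 * (dA + dB))" by (rule fits_mono) simp
    fix s
    have "eqv (set ts) s ((layer (\<lambda>t. mat_adjoint (V t)) ts @ M) @ layer V ts)
        (layer (\<lambda>t. V t * (K s t * mat_adjoint (V t))) ts)"
      by (intro eqv_layer_append eqv_refl eM ts(1) mat2_mult_carrier carK carV)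
    moreover have "layer (\<lambda>t. V t * (K s t * mat_adjoint (V t))) ts
      = layer (\<lambda>t. if F s \<and> G s then W t else 1\<^sub>m 2) ts"
      using V left_mult_one_mat[OF carV(2)]
      by (intro layer_cong) (auto simp: K_def WV unitary_mat_def)
    ultimately show "eqv (set ts) s gs (layer (\<lambda>t. if F s \<and> G s then W t else 1\<^sub>m 2) ts)"
      by (simp add: gs_def)
  qed
qed

section \<open>Conjunctions of few controls and fan-out\<close>

lemma X_if_cong: "X_if N F l ts gs \<Longrightarrow> (\<And>s. F s = G s) \<Longrightarrow> X_if N G l ts gs"
  by (simp add: X_if_def)

lemma X_if_True: "t < N \<Longrightarrow> X_if N (\<lambda>s. True) (\<lambda>_. 1) [t] [Single t (X_mat 1)]"
  by (simp add: X_if_def unitary_X_mat)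

lemma X_if_CNOT:
  assumes "c < N" "t < N" "c \<noteq> t"
  shows "X_if N (\<lambda>s. s c) (\<lambda>_. 1) [t] [CNOT c t]"
proof -
  have "eqv {t} s [CNOT c t] (layer (\<lambda>t. if s c then X_mat 1 else 1\<^sub>m 2) [t])" for s
  proof (rule eqv_trans[OF eqv_CNOT[of c "{t}" s t]])
    show "eqv {t} s (if s c then [Single t (mat2 0 1 1 0)] else []) (layer (\<lambda>t. if s c then X_mat 1 else 1\<^sub>m 2) [t])"
      by (rule eqv_sem) (simp add: X_mat_def del: gate_app.simps)
  qed (use assms in simp)
  then show ?thesis using assms by (simp add: X_if_def)
qed

text \<open>The NOT gate has determinant -1; the factor \<i> corrects it, so that the commutator
  construction applies to it.\<close>

lemma X_mat_SU2: "X_mat \<i> \<in> SU2"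
  by (simp add: SU2_def unitary_X_mat) (simp add: X_mat_def mat2_det)

lemma X_if_conj:
  assumes "t < N" "X_if N F l [t] A" "X_if N G k [t] B" "fits A dA" "fits B dB"
  obtains gs where "X_if N (\<lambda>s. F s \<and> G s) (\<lambda>_. \<i>) [t] gs"
    "cnot_count gs = 2 * (cnot_count A + cnot_count B)" "fits gs (6 + 2 * (dA + dB))"
proof (rule commutator_circuit[of "[t]" N "\<lambda>_. X_mat \<i>" F l A G k B dA dB])
  fix gs assume gs: "valid_circuit N gs"
    "\<And>s. eqv (set [t]) s gs (layer (\<lambda>t. if F s \<and> G s then X_mat \<i> else 1\<^sub>m 2) [t])"
    "cnot_count gs = 2 * (cnot_count A + cnot_count B)" "fits gs (6 + 2 * (dA + dB))"
  show thesis
    by (rule that[of gs]) (use gs in \<open>simp_all add: X_if_def\<close>)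
qed (use assms X_mat_SU2 in auto)

text \<open>Balanced commutators cost 1, 4, 10 and 16 CNOTs with depths 1, 10, 28 and 46 for one to
  four controls. The saving of 4 against \<open>6 * card S\<close> contributes 8 to the final
  count.\<close>

lemma and_gate_exists:
  assumes "1 \<le> card S" "card S \<le> 4" "S \<subseteq> {..<N} - {t}" "t < N"
  obtains gs l where "X_if N (\<lambda>s. \<forall>c\<in>S. s c) l [t] gs" "cnot_count gs + 4 \<le> 6 * card S" "fits gs 46"
proof -
  have 1: "X_if N (\<lambda>s. s c) (\<lambda>_. 1) [t] [CNOT c t]" "fits [CNOT c t] 1" if "c \<in> S" for c
    using that assms X_if_CNOT fits_length[of "[CNOT c t]"] by auto
  have 2: "\<exists>gs. X_if N (\<lambda>s. s c \<and> s d) (\<lambda>_. \<i>) [t] gs \<and> cnot_count gs = 4 \<and> fits gs 10"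
    if "c \<in> S" "d \<in> S" for c d
    by (rule X_if_conj[OF assms(4) 1(1)[OF that(1)] 1(1)[OF that(2)] 1(2)[OF that(1)] 1(2)[OF that(2)]]) auto
  obtain xs where xs: "set xs = S" "distinct xs"
    using assms finite_distinct_list[of S] by (metis card.infinite not_one_le_zero)
  then have "length xs = card S" by (metis distinct_card)
  with assms(1,2) consider a where "xs = [a]" | a b where "xs = [a, b]"
    | a b c where "xs = [a, b, c]" | a b c d where "xs = [a, b, c, d]"
    by (cases xs; cases "tl xs"; cases "tl (tl xs)"; cases "tl (tl (tl xs))"; cases "tl (tl (tl (tl xs)))") auto
  then show ?thesis
  proof cases
    case 1
    then have "S = {a}" using xs by auto
    with \<open>\<And>c. c \<in> S \<Longrightarrow> X_if N (\<lambda>s. s c) _ _ _\<close> \<open>\<And>c. c \<in> S \<Longrightarrow> fits _ _\<close>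
    show ?thesis
      by (intro that[of "\<lambda>_. 1" "[CNOT a t]"]) (auto intro: fits_mono)
  next
    case (2 a b)
    then have S: "S = {a, b}" "card S = 2" using xs \<open>length xs = card S\<close> by auto
    with \<open>\<And>c d. c \<in> S \<Longrightarrow> d \<in> S \<Longrightarrow> _\<close>[of a b] obtain gs
      where "X_if N (\<lambda>s. s a \<and> s b) (\<lambda>_. \<i>) [t] gs" "cnot_count gs = 4" "fits gs 10" by auto
    with S show ?thesis
      by (intro that[of "\<lambda>_. \<i>" gs]) (auto elim!: X_if_cong fits_mono)
  next
    case (3 a b c)
    then have S: "S = {a, b, c}" "card S = 3" using xs \<open>length xs = card S\<close> by auto
    with 2[of a b] obtain gs
      where gs: "X_if N (\<lambda>s. s a \<and> s b) (\<lambda>_. \<i>) [t] gs" "cnot_count gs = 4" "fits gs 10" by auto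
    obtain hs where "X_if N (\<lambda>s. (s a \<and> s b) \<and> s c) (\<lambda>_. \<i>) [t] hs" "cnot_count hs = 10" "fits hs 28"
      using S by (rule_tac X_if_conj[OF assms(4) gs(1) 1(1)[of c] gs(3) 1(2)[of c]]) (auto simp: gs(2))
    with S show ?thesis
      by (intro that[of "\<lambda>_. \<i>" hs]) (auto elim!: X_if_cong fits_mono)
  next
    case (4 a b c d)
    then have S: "S = {a, b, c, d}" "card S = 4" using xs \<open>length xs = card S\<close> by auto
    with 2[of a b] obtain gs
      where gs: "X_if N (\<lambda>s. s a \<and> s b) (\<lambda>_. \<i>) [t] gs" "cnot_count gs = 4" "fits gs 10" by auto
    from S 2[of c d] obtain gs'
      where gs': "X_if N (\<lambda>s. s c \<and> s d) (\<lambda>_. \<i>) [t] gs'" "cnot_count gs' = 4" "fits gs' 10" by auto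
    obtain hs where "X_if N (\<lambda>s. (s a \<and> s b) \<and> (s c \<and> s d)) (\<lambda>_. \<i>) [t] hs" "cnot_count hs = 16" "fits hs 46"
      by (rule X_if_conj[OF assms(4) gs(1) gs'(1) gs(3) gs'(3)]) (auto simp: gs(2) gs'(2))
    with S show ?thesis
      by (intro that[of "\<lambda>_. \<i>" hs]) (auto elim!: X_if_cong fits_mono)
  qed
qed

section \<open>Fan-out by a tree of CNOTs\<close>

lemma app_X_mat: "gate_app (Single q (X_mat l)) \<psi> s = l * \<psi> (s(q := \<not> s q))"
  by (cases "s q") (auto simp: X_mat_def)

text \<open>Propagation of a bit flip on the control to the target. The phase \<open>l\<close> is a
  global factor and can be left with \<open>t\<close>.\<close>

lemma CNOT_X_mat:
  assumes "t \<noteq> u"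
  shows "gate_app (CNOT t u) (gate_app (Single t (X_mat l)) \<psi>)
    = gate_app (Single t (X_mat l)) (gate_app (Single u (X_mat 1)) (gate_app (CNOT t u) \<psi>))"
proof
  fix s
  show "gate_app (CNOT t u) (gate_app (Single t (X_mat l)) \<psi>) s
    = gate_app (Single t (X_mat l)) (gate_app (Single u (X_mat 1)) (gate_app (CNOT t u) \<psi>)) s"
    using assms by (simp add: app_X_mat fun_upd_twist[OF assms] del: gate_app.simps(1))
qed

text \<open>One CNOT passes the flip from \<open>t\<close> to the head \<open>u\<close> of the
  second half; then both halves spread it in parallel on disjoint qubits. Each level doubles the
  number of reachable targets.\<close>

lemma fan_out_exists:
  assumes "distinct (t # us)" "\<And>u. u \<in> set (t # us) \<Longrightarrow> u < N" "length (t # us) \<le> 2 ^ j"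
  shows "\<exists>P. valid_circuit N P \<and> cqubits P \<subseteq> set (t # us) \<and> cnot_count P = length us \<and> fits P j \<and>
    (\<forall>l \<psi>. sem P (gate_app (Single t (X_mat l)) \<psi>)
       = sem (layer (\<lambda>u. X_mat (if u = t then l else 1)) (t # us)) (sem P \<psi>))"
  using assms
proof (induction j arbitrary: t us)
  case 0
  then show ?case by (intro exI[of _ "[]"]) auto
next
  case (Suc j)
  show ?case
  proof (cases "us = []")
    case True
    then show ?thesis by (intro exI[of _ "[]"]) auto
  next
    case False
    \<comment> \<open>Rounding down leaves \<open>h + 1\<close> qubits with \<open>t\<close> and
      \<open>length us - h\<close> with \<open>u\<close>, both at most \<open>2 ^ j\<close>.\<close>
    define h where "h = length us div 2"
    define u where "u = us ! h"
    define vs ws where "vs = take h us" and "ws = drop (Suc h) us"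
    have "h < length us" using False by (auto simp: h_def)
    then have us: "us = vs @ u # ws" by (simp add: vs_def ws_def u_def id_take_nth_drop)
    have len: "length (t # vs) \<le> 2 ^ j" "length (u # ws) \<le> 2 ^ j"
      using Suc.prems(3) \<open>h < length us\<close> by (auto simp: vs_def ws_def h_def)
    have tu: "t \<noteq> u" "u \<notin> set vs" "t \<notin> set ws" "t \<notin> set vs" "u \<notin> set ws" "set vs \<inter> set ws = {}" using Suc.prems(1) us by auto
    have dist: "distinct (t # vs)" "distinct (u # ws)" using Suc.prems(1) us by auto
    have bound: "\<And>v. v \<in> set (t # vs) \<Longrightarrow> v < N" "\<And>v. v \<in> set (u # ws) \<Longrightarrow> v < N"
      using Suc.prems(2) us by auto
    obtain P where P: "valid_circuit N P" "cqubits P \<subseteq> set (t # vs)" "cnot_count P = length vs" "fits P j"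
      "\<And>l \<psi>. sem P (gate_app (Single t (X_mat l)) \<psi>)
         = sem (layer (\<lambda>u. X_mat (if u = t then l else 1)) (t # vs)) (sem P \<psi>)"
      using Suc.IH[OF dist(1) bound(1) len(1)] by blast
    obtain Q where Q: "valid_circuit N Q" "cqubits Q \<subseteq> set (u # ws)" "cnot_count Q = length ws" "fits Q j"
      "\<And>l \<psi>. sem Q (gate_app (Single u (X_mat l)) \<psi>)
         = sem (layer (\<lambda>v. X_mat (if v = u then l else 1)) (u # ws)) (sem Q \<psi>)"
      using Suc.IH[OF dist(2) bound(2) len(2)] by blast
    let ?Lv = "\<lambda>l. layer (\<lambda>u. X_mat (if u = t then l else 1)) (t # vs)"
    let ?Lw = "layer (\<lambda>v. X_mat (if v = u then 1 else 1)) (u # ws)"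
    have disj: "cqubits P \<inter> cqubits Q = {}" "cqubits P \<inter> {u} = {}" "cqubits (?Lv l) \<inter> cqubits Q = {}" for l
      using P(2) Q(2) tu by auto
    let ?R = "[CNOT t u] @ (P @ Q)"
    have "sem ?R (gate_app (Single t (X_mat l)) \<psi>) = sem (layer (\<lambda>u. X_mat (if u = t then l else 1)) (t # us)) (sem ?R \<psi>)"
      for l \<psi>
    proof -
      let ?c = "gate_app (CNOT t u) \<psi>" and ?Xu = "gate_app (Single u (X_mat 1))"
      have "sem ?R (gate_app (Single t (X_mat l)) \<psi>) = sem Q (sem P (gate_app (Single t (X_mat l)) (?Xu ?c)))"
        by (simp add: sem_append sem_Cons CNOT_X_mat[OF tu(1)] del: gate_app.simps)
      also have "\<dots> = sem Q (sem (?Lv l) (sem P (?Xu ?c)))"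
        by (simp only: P(5))
      also have "\<dots> = sem (?Lv l) (sem Q (?Xu (sem P ?c)))"
        using disj(2) by (simp add: sem_commute[OF disj(3)] sem_app_commute Int_commute del: gate_app.simps layer_simps)
      also have "\<dots> = sem (?Lv l) (sem ?Lw (sem Q (sem P ?c)))"
        by (simp only: Q(5))
      also have "\<dots> = sem (?Lw @ ?Lv l) (sem ?R \<psi>)"
        by (simp add: sem_append sem_Cons del: gate_app.simps layer_simps)
      also have "\<dots> = sem (?Lv l @ ?Lw) (sem ?R \<psi>)"
        using tu unfolding sem_append by (intro sem_commute) auto
      also have "?Lv l @ ?Lw = layer (\<lambda>u. X_mat (if u = t then l else 1)) (t # us)"
        using tu by (auto simp: us layer_def)
      finally show ?thesis .
    qed
    moreover have "fits ?R (1 + j)"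
      using P(4) Q(4) disj(1) fits_length[of "[CNOT t u]"]
      by (intro fits_append fits_append_disjoint) auto
    moreover have "valid_circuit N ?R" "cqubits ?R \<subseteq> set (t # us)" "cnot_count ?R = length us"
      using P Q us Suc.prems(2) tu by auto
    ultimately show ?thesis by (intro exI[of _ ?R]) (simp del: gate_app.simps)
  qed
qed

text \<open>Conjugating \<open>U\<close> by the tree turns its flip of \<open>t\<close> into a flip
  of all targets. When the condition fails, the tree and its inverse cancel.\<close>

lemma X_if_fan_out:
  assumes X: "X_if N F l [t] U" and ts: "distinct (t # us)" "\<And>u. u \<in> set (t # us) \<Longrightarrow> u < N"
    and F: "\<And>s s'. agree_off (set (t # us)) s s' \<Longrightarrow> F s' = F s"
    and U: "fits U d" and j: "length (t # us) \<le> 2 ^ j"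
  obtains gs k where "X_if N F k (t # us) gs" "cnot_count gs = cnot_count U + 2 * length us" "fits gs (d + 2 * j)"
proof -
  obtain P where P: "valid_circuit N P" "cqubits P \<subseteq> set (t # us)" "cnot_count P = length us" "fits P j"
      "\<And>l \<psi>. sem P (gate_app (Single t (X_mat l)) \<psi>)
         = sem (layer (\<lambda>u. X_mat (if u = t then l else 1)) (t # us)) (sem P \<psi>)"
    using fan_out_exists[OF ts j] by blast
  let ?gs = "cinv P @ (U @ P)"
  let ?k = "\<lambda>u. if u = t then l t else 1"
  let ?f = "\<lambda>s t. if F s then X_mat (l t) else 1\<^sub>m 2"
  let ?g = "\<lambda>s u. if F s then X_mat (?k u) else 1\<^sub>m 2"
  have "eqv (set (t # us)) s ?gs (layer (?g s) (t # us))" for s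
  proof (rule eqv_trans)
    have "eqv (set (t # us)) s U (layer (?f s) [t])"
    \<comment> \<open>The tree changes the other targets too, so the slice of \<open>U\<close> is
      widened from \<open>t\<close> to all of them; this is where invariance of \<open>F\<close>
      enters.\<close>
    proof (rule eqv_mono)
      fix s' assume "agree_off (set (t # us)) s s'"
      then have "F s' = F s" by (rule F)
      then show "eqv {t} s' U (layer (?f s) [t])"
        using X unfolding X_if_def by (metis empty_set list.simps(15))
    qed
    then show "eqv (set (t # us)) s ?gs (cinv P @ (layer (?f s) [t] @ P))"
      using P(2) by (intro eqv_append) auto
    show "eqv (set (t # us)) s (cinv P @ (layer (?f s) [t] @ P)) (layer (?g s) (t # us))"
    proof (rule eqv_sem)
      fix \<psi>
      show "sem (cinv P @ (layer (?f s) [t] @ P)) \<psi> = sem (layer (?g s) (t # us)) \<psi>"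
      proof (cases "F s")
        case True
        then have "sem (cinv P @ (layer (?f s) [t] @ P)) \<psi>
            = sem P (gate_app (Single t (X_mat (l t))) (sem (cinv P) \<psi>))"
          by (simp add: sem_append sem_Cons del: gate_app.simps)
        also have "\<dots> = sem (layer (?g s) (t # us)) \<psi>"
          unfolding P(5) sem_cinv(2)[OF P(1)] using True by (simp del: layer_simps)
        finally show ?thesis .
      next
        case False
        then show ?thesis using P(1) by (simp add: sem_append sem_Cons sem_layer_one del: gate_app.simps)
      qed
    qed
  qed
  moreover have "valid_circuit N ?gs" "\<forall>u\<in>set (t # us). ?k u * cnj (?k u) = 1"
    using X P(1) by (auto simp: X_if_def)
  moreover have "fits ?gs (j + (d + j))"
    using P(4) U by (intro fits_append fits_cinv)
  ultimately show ?thesis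
    using P(3) by (intro that[of ?k ?gs]) (auto simp: X_if_def elim!: fits_mono)
qed

section \<open>Relative-phase Toffoli gates\<close>

text \<open>The rotation about the y-axis by the angle pi/4; the entries use half the angle.\<close>

definition margolus_mat :: "complex mat" where
  "margolus_mat = mat2 (of_real (cos (pi / 8))) (- of_real (sin (pi / 8)))
     (of_real (sin (pi / 8))) (of_real (cos (pi / 8)))"

text \<open>Margolus' relative-phase Toffoli gate with controls \<open>p\<close>, \<open>q\<close>
  and target \<open>r\<close>, followed by a NOT because a clean target holds 1.\<close>

fun gadget :: "nat \<times> nat \<times> nat \<Rightarrow> circuit" where
  "gadget (p, q, r) = [Single r margolus_mat, CNOT q r, Single r margolus_mat, CNOT p r,
     Single r (mat_adjoint margolus_mat), CNOT q r, Single r (mat_adjoint margolus_mat), Single r (X_mat 1)]"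

text \<open>
  An ancilla is clean when it is in state 1. This way the all-ones state is fixed by every step,
  and the qubits that produced a true conjunction are clean again.
\<close>

fun gadget_step :: "nat \<times> nat \<times> nat \<Rightarrow> (nat \<Rightarrow> bool) \<Rightarrow> nat \<Rightarrow> bool" where
  "gadget_step (p, q, r) s = s(r := (s r = (s p \<and> s q)))"

lemma margolus_carrier [simp]: "margolus_mat \<in> carrier_mat 2 2"
  by (simp add: margolus_mat_def)

lemma margolus_unitary: "unitary_mat 2 margolus_mat"
  using sin_cos_squared_add3[of "pi / 8"]
  by (simp add: margolus_mat_def unitary_mat2 mat2_simps add.commute mult.commute
      flip: of_real_mult of_real_add)

text \<open>\<open>X\<close> inverts the rotation \<open>A\<close>. If \<open>P\<close> fails, all
  rotations cancel; if \<open>P\<close> and \<open>Q\<close> hold, the NOTs cancel as well. If only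
  \<open>P\<close> holds, the rotations add up to the angle pi, which flips the bit with a
  sign.\<close>

lemma gadget_matrix:
  fixes P Q :: bool
  defines "A \<equiv> margolus_mat" and "X \<equiv> \<lambda>b. if b then X_mat 1 else 1\<^sub>m 2"
  shows "X_mat 1 * (mat_adjoint A * (X Q * (mat_adjoint A * (X P * (A * (X Q * A))))))
    = (if P \<and> Q then 1\<^sub>m 2 else if P then mat2 0 (-1) 1 0 else X_mat 1)"
proof -
  define c s where "c = complex_of_real (cos (pi / 8))" and "s = complex_of_real (sin (pi / 8))"
  define h where "h = c * c - s * s"
  have A: "A = mat2 c (- s) s c" by (simp add: A_def margolus_mat_def c_def s_def)
  define B where "B = mat_adjoint A"
  have B: "B = mat2 c s (- s) c" by (simp add: B_def A mat2_adjoint c_def s_def)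
  have "complex_of_real (cos (pi / 8) * cos (pi / 8) + sin (pi / 8) * sin (pi / 8)) = 1"
    using sin_cos_squared_add3[of "pi / 8"] by (simp only: of_real_1)
  then have cs: "c * c + s * s = 1"
    by (simp only: c_def s_def of_real_add of_real_mult)
  \<comment> \<open>Sine and cosine agree at pi/4, so all entries of \<open>A * A\<close> are
    \<open>h\<close> up to sign.\<close>
  have "cos (2 * (pi / 8)) = sin (2 * (pi / 8))"
    by (simp add: cos_45 sin_45)
  then have r: "cos (pi / 8) * cos (pi / 8) - sin (pi / 8) * sin (pi / 8) = 2 * sin (pi / 8) * cos (pi / 8)"
    by (simp only: cos_double sin_double power2_eq_square)
  have "h = complex_of_real (cos (pi / 8) * cos (pi / 8) - sin (pi / 8) * sin (pi / 8))"
    by (simp only: h_def c_def s_def of_real_diff of_real_mult)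
  also have "\<dots> = 2 * (c * s)"
    unfolding r by (simp add: c_def s_def)
  finally have h: "2 * (c * s) = h" by simp
  have "h * h + (2 * (c * s)) * (2 * (c * s)) = (c * c + s * s) * (c * c + s * s)"
    by (simp add: h_def algebra_simps)
  then have hh: "2 * (h * h) = 1" unfolding h cs by simp
  have hs: "c * c - s * s = h" "c * s + s * c = h" using h by (simp_all add: h_def mult.commute)
  have AA: "A * A = mat2 h (- h) h h" "B * B = mat2 h h (- h) h"
    using hs by (auto simp: A B mat2_mult mat2_eq_iff algebra_simps)
  have inv: "A * B = 1\<^sub>m 2" "B * A = 1\<^sub>m 2"
    using cs by (simp_all add: B A mat2_simps add.commute)
  have AX: "X_mat 1 * (A * X_mat 1) = B" "X_mat 1 * (B * X_mat 1) = A" "X_mat 1 * X_mat 1 = 1\<^sub>m 2"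
    by (simp_all add: B A X_mat_def mat2_simps)
  have car: "A \<in> carrier_mat 2 2" "B \<in> carrier_mat 2 2" "X_mat 1 \<in> carrier_mat 2 2"
    by (simp_all add: A B)
  have Z: "B * (A * Z) = Z" "X_mat 1 * (X_mat 1 * Z) = Z" "X_mat 1 * (A * (X_mat 1 * Z)) = B * Z"
    "X_mat 1 * (B * (X_mat 1 * Z)) = A * Z" "B * (B * Z) = mat2 h h (- h) h * Z" if "Z \<in> carrier_mat 2 2" for Z
  proof -
    have "B * (A * Z) = (B * A) * Z" using that car by simp
    then show "B * (A * Z) = Z" using that inv by simp
    have "X_mat 1 * (X_mat 1 * Z) = (X_mat 1 * X_mat 1) * Z"
      by (rule assoc_mult_mat[OF car(3) car(3) that, symmetric])
    then show "X_mat 1 * (X_mat 1 * Z) = Z" using that AX by simp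
    have "X_mat 1 * (A * (X_mat 1 * Z)) = (X_mat 1 * (A * X_mat 1)) * Z"
      by (subst assoc_mult_mat[of _ 2 2 _ 2 _ 2], use that car in simp_all)
        (subst assoc_mult_mat[of _ 2 2 _ 2 _ 2], use that car in simp_all)
    then show "X_mat 1 * (A * (X_mat 1 * Z)) = B * Z" by (simp only: AX)
    have "X_mat 1 * (B * (X_mat 1 * Z)) = (X_mat 1 * (B * X_mat 1)) * Z"
      by (subst assoc_mult_mat[of _ 2 2 _ 2 _ 2], use that car in simp_all)
        (subst assoc_mult_mat[of _ 2 2 _ 2 _ 2], use that car in simp_all)
    then show "X_mat 1 * (B * (X_mat 1 * Z)) = A * Z" by (simp only: AX)
    have "B * (B * Z) = (B * B) * Z" using that car by simp
    then show "B * (B * Z) = mat2 h h (- h) h * Z" by (simp only: AA)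
  qed
  note one = left_mult_one_mat[of _ 2 2] right_mult_one_mat[of _ 2 2]
  have "X_mat 1 * (B * (X Q * (B * (X P * (A * (X Q * A))))))
    = (if P \<and> Q then 1\<^sub>m 2 else if P then mat2 0 (-1) 1 0 else X_mat 1)"
  proof (cases "P \<and> \<not> Q")
    case True
    then have "X_mat 1 * (B * (X Q * (B * (X P * (A * (X Q * A)))))) = X_mat 1 * (B * (B * (X_mat 1 * (A * A))))"
      using car by (simp add: X_def one)
    also have "\<dots> = X_mat 1 * (mat2 h h (- h) h * (X_mat 1 * mat2 h (- h) h h))"
      unfolding AA(1) using mult_carrier_mat[OF car(3) mat2_carrier] by (subst Z(5)) simp_all
    also have "\<dots> = mat2 0 (-1) 1 0" using hh by (simp add: X_mat_def mat2_simps)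
    finally show ?thesis using True by simp
  next
    case False
    then show ?thesis
      using car mult_carrier_mat[OF car(3,1)] AX inv by (cases P; cases Q) (simp_all add: X_def one Z(1-4))
  qed
  then show ?thesis by (simp only: B_def)
qed

text \<open>Every matrix in \<open>gadget_matrix\<close> has one nonzero entry per row. The phase
  may stay unspecified, since it is later undone by the inverse circuit.\<close>

lemma gadget_monomial:
  assumes pq: "p \<noteq> r" "q \<noteq> r"
  shows "\<exists>\<phi>. \<forall>\<chi> s. sem (gadget (p, q, r)) \<chi> s = \<phi> s * \<chi> (gadget_step (p, q, r) s)"
proof -
  let ?A = margolus_mat
  define X where "X b = (if b then X_mat 1 else 1\<^sub>m 2)" for b
  define K where "K P Q = (if P \<and> Q then 1\<^sub>m 2 else if P then mat2 0 (-1) 1 0 else X_mat 1)" for P Q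
  have "sem (gadget (p, q, r)) \<chi> s
     = K (s p) (s q) $$ (of_bool (s r), of_bool (s r = (s p \<and> s q))) * \<chi> (gadget_step (p, q, r) s)"
    for \<chi> s
  proof -
    have C: "eqv (set [r]) s [CNOT c r] (layer (\<lambda>_. X (s c)) [r])" if "c \<noteq> r" for c
    proof -
      \<comment> \<open>\<open>X_if_CNOT\<close> asks for a number of qubits; any bound above both
        serves.\<close>
      have "c < Suc (c + r)" "r < Suc (c + r)" by auto
      from X_if_CNOT[OF this that] show ?thesis by (simp add: X_if_def X_def)
    qed
    have S: "eqv (set [r]) s [Single r U] (layer (\<lambda>_. U) [r])" for U by simp
    have "eqv (set [r]) s ((((((([Single r ?A] @ [CNOT q r]) @ [Single r ?A]) @ [CNOT p r]) @
        [Single r (mat_adjoint ?A)]) @ [CNOT q r]) @ [Single r (mat_adjoint ?A)]) @ [Single r (X_mat 1)])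
       (layer (\<lambda>_. X_mat 1 * (mat_adjoint ?A * (X (s q) * (mat_adjoint ?A * (X (s p) * (?A * (X (s q) * ?A))))))) [r])"
      by (intro eqv_layer_append C S pq mat2_mult_carrier mat2_adjoint_carrier)
        (auto simp: X_def)
    also have "X_mat 1 * (mat_adjoint ?A * (X (s q) * (mat_adjoint ?A * (X (s p) * (?A * (X (s q) * ?A)))))) = K (s p) (s q)"
      unfolding X_def K_def by (rule gadget_matrix)
    finally have "sem (gadget (p, q, r)) \<chi> s = gate_app (Single r (K (s p) (s q))) \<chi> s"
      by (simp add: eqv_def del: gate_app.simps)
    then show ?thesis
      by (cases "s r"; cases "s p"; cases "s q") (simp_all add: K_def X_mat_def mat2_one)
  qed
  then show ?thesis
    by (intro exI[of _ "\<lambda>s. K (s p) (s q) $$ (of_bool (s r), of_bool (s r = (s p \<and> s q)))"] allI)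
qed

text \<open>
  Since \<open>sem\<close> pulls amplitudes back, the circuit whose amplitudes are read at \<open>run ts s\<close> has its gates
  in reverse order: it is the inverse of the computation \<open>run ts\<close>.
\<close>

definition gadgets :: "(nat \<times> nat \<times> nat) list \<Rightarrow> circuit" where
  "gadgets ts = concat (map gadget (rev ts))"

definition run :: "(nat \<times> nat \<times> nat) list \<Rightarrow> (nat \<Rightarrow> bool) \<Rightarrow> nat \<Rightarrow> bool" where
  "run ts = fold gadget_step ts"

lemma gadgets_simps [simp]:
  "gadgets [] = []" "gadgets (x # ts) = gadgets ts @ gadget x" "gadgets (ts @ us) = gadgets us @ gadgets ts"
  by (simp_all add: gadgets_def)

lemma run_simps [simp]:
  "run [] s = s" "run (x # ts) s = run ts (gadget_step x s)" "run (ts @ us) s = run us (run ts s)"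
  by (simp_all add: run_def)

definition gadgets_ok :: "nat set \<Rightarrow> (nat \<times> nat \<times> nat) list \<Rightarrow> bool" where
  "gadgets_ok Q ts \<longleftrightarrow> (\<forall>(p, q, r)\<in>set ts. p \<in> Q \<and> q \<in> Q \<and> r \<in> Q \<and> p \<noteq> r \<and> q \<noteq> r)"

lemma gadgets_ok_simps [simp]:
  "gadgets_ok Q []"
  "gadgets_ok Q ((p, q, r) # ts) \<longleftrightarrow> p \<in> Q \<and> q \<in> Q \<and> r \<in> Q \<and> p \<noteq> r \<and> q \<noteq> r \<and> gadgets_ok Q ts"
  "gadgets_ok Q (ts @ us) \<longleftrightarrow> gadgets_ok Q ts \<and> gadgets_ok Q us"
  by (simp_all add: gadgets_ok_def ball_Un)

lemma gadgets_ok_mono: "gadgets_ok Q ts \<Longrightarrow> Q \<subseteq> Q' \<Longrightarrow> gadgets_ok Q' ts"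
  by (auto simp: gadgets_ok_def)

lemma gadgets_monomial:
  assumes "gadgets_ok Q ts"
  shows "\<exists>\<phi>. \<forall>\<chi> s. sem (gadgets ts) \<chi> s = \<phi> s * \<chi> (run ts s)"
  using assms
proof (induction ts)
  case Nil
  then show ?case by (intro exI[of _ "\<lambda>_. 1"]) simp
next
  case (Cons x ts)
  obtain p q r where x: "x = (p, q, r)" by (cases x)
  with Cons obtain \<phi> where \<phi>: "\<And>\<chi> s. sem (gadgets ts) \<chi> s = \<phi> s * \<chi> (run ts s)" by auto
  obtain \<phi>' where "\<And>\<chi> s. sem (gadget x) \<chi> s = \<phi>' s * \<chi> (gadget_step x s)"
    using gadget_monomial[of p r q] Cons.prems unfolding x by auto
  with \<phi> show ?case
    by (intro exI[of _ "\<lambda>s. \<phi>' s * \<phi> (gadget_step x s)"]) (simp add: sem_append)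
qed

lemma gadgets_valid:
  assumes "gadgets_ok Q ts" "Q \<subseteq> {..<N}"
  shows "valid_circuit N (gadgets ts)" "cqubits (gadgets ts) \<subseteq> Q" "cnot_count (gadgets ts) = 3 * length ts"
  using assms
  by (induction ts) (auto simp: margolus_unitary unitary_mat_adjoint unitary_X_mat)

lemma run_other: "gadgets_ok Q ts \<Longrightarrow> q \<notin> Q \<Longrightarrow> run ts s q = s q"
proof (induction ts arbitrary: s)
  case (Cons x ts)
  obtain p r t where "x = (p, r, t)" by (cases x)
  with Cons show ?case by auto
qed simp

text \<open>This is what makes qubits reusable: ancillas and controls that all start in state 1 are
  again in state 1 after a net has used them.\<close>

lemma run_all_True: "gadgets_ok Q ts \<Longrightarrow> (\<And>q. q \<in> Q \<Longrightarrow> s q) \<Longrightarrow> q \<in> Q \<Longrightarrow> run ts s q"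
  by (induction ts arbitrary: s) auto

lemma run_cong: "gadgets_ok Q ts \<Longrightarrow> (\<And>q. q \<in> Q \<Longrightarrow> s q = s' q) \<Longrightarrow> q \<in> Q \<Longrightarrow> run ts s q = run ts s' q"
proof (induction ts arbitrary: s s')
  case (Cons x ts)
  obtain p q r where "x = (p, q, r)" by (cases x)
  with Cons.prems show ?case by (simp, intro Cons.IH) auto
qed simp

section \<open>Conjunctions with conditionally clean ancillas\<close>

text \<open>\<open>Z\<close> holds the ancillas, \<open>C\<close> the controls and \<open>w\<close>
  receives the conjunction. Correctness is promised only for clean ancillas. One gadget per binary
  conjunction makes one fewer than controls; the \<open>Suc\<close> also forces \<open>C\<close> to
  be finite and nonempty.\<close>

definition and_net :: "nat set \<Rightarrow> nat set \<Rightarrow> (nat \<times> nat \<times> nat) list \<Rightarrow> nat \<Rightarrow> bool" where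
  "and_net Z C ts w \<longleftrightarrow> gadgets_ok (Z \<union> C) ts \<and> w \<in> Z \<union> C \<and> Suc (length ts) = card C \<and>
     (\<forall>s. (\<forall>z\<in>Z. s z) \<longrightarrow> (run ts s w \<longleftrightarrow> (\<forall>c\<in>C. s c)))"

lemma and_netD:
  assumes "and_net Z C ts w"
  shows "gadgets_ok (Z \<union> C) ts" "w \<in> Z \<union> C" "\<forall>z\<in>Z. s z \<Longrightarrow> run ts s w \<longleftrightarrow> (\<forall>c\<in>C. s c)"
  using assms by (simp_all add: and_net_def)

text \<open>If \<open>w\<close> is true, then \<open>Y\<close> and \<open>A\<close> are all in state
  1 after the first net and may serve the second as ancillas. If \<open>w\<close> is false, the
  value of \<open>v\<close> does not matter. The pool leaves out \<open>w\<close>, which must keep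
  its value, and \<open>q\<close>, the clean output.\<close>

lemma and_net_combine:
  assumes A: "and_net Y A ts w" and C: "and_net Y' C us v"
    and Y: "Y \<subseteq> Z - {q}" "Y' \<subseteq> Z \<union> A - {w, q}" "q \<in> Z"
    and disj: "Z \<inter> A = {}" "Z \<inter> C = {}" "A \<inter> C = {}" and fin: "finite A" "finite C"
  shows "and_net Z (A \<union> C) (ts @ us @ [(w, v, q)]) q"
  unfolding and_net_def
proof (intro conjI allI impI)
  have ok: "gadgets_ok (Y \<union> A) ts" "gadgets_ok (Y' \<union> C) us" and w: "w \<in> Y \<union> A" and v: "v \<in> Y' \<union> C"
    using A C by (auto simp: and_net_def)
  then have "gadgets_ok (Z \<union> (A \<union> C)) ts" "gadgets_ok (Z \<union> (A \<union> C)) us"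
    using Y by (blast intro: gadgets_ok_mono)+
  moreover have q: "w \<noteq> q" "v \<noteq> q" "q \<notin> Y \<union> A" "q \<notin> Y' \<union> C" and wC: "w \<notin> Y' \<union> C"
    using w v Y disj by blast+
  ultimately show "gadgets_ok (Z \<union> (A \<union> C)) (ts @ us @ [(w, v, q)])"
    using w v Y(3) subsetD[OF Y(1)] subsetD[OF Y(2)] by simp blast
  show "Suc (length (ts @ us @ [(w, v, q)])) = card (A \<union> C)"
    using A C disj fin by (simp add: and_net_def card_Un_disjoint)
  show "q \<in> Z \<union> (A \<union> C)" using Y by simp
  fix s :: "nat \<Rightarrow> bool" assume Z: "\<forall>z\<in>Z. s z"
  define s1 where "s1 = run ts s"
  define s2 where "s2 = run us s1"
  have sY: "\<forall>z\<in>Y. s z" using Z Y(1) by blast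
  then have w1: "s1 w \<longleftrightarrow> (\<forall>a\<in>A. s a)"
    using A by (simp add: and_net_def s1_def)
  have w2: "s2 w = s1 w" unfolding s2_def by (rule run_other[OF ok(2) wC])
  have "s q" using Z Y(3) by blast
  then have q2: "s2 q"
    unfolding s2_def s1_def by (simp only: run_other[OF ok(2) q(4)] run_other[OF ok(1) q(3)])
  have C1: "s1 c = s c" if "c \<in> C" for c
  proof -
    have "c \<notin> Y \<union> A" using that disj Y(1) by blast
    then show ?thesis unfolding s1_def by (rule run_other[OF ok(1)])
  qed
  \<comment> \<open>The second net is analysed only under \<open>s1 w\<close>; otherwise its
    ancillas may be dirty.\<close>
  have v2: "s2 v \<longleftrightarrow> (\<forall>c\<in>C. s c)" if "s1 w"
  proof -
    have sYA: "s q'" if "q' \<in> Y \<union> A" for q' using that \<open>s1 w\<close> w1 sY by blast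
    have "s1 z" if "z \<in> Y'" for z
    proof (cases "z \<in> Y \<union> A")
      case True
      from run_all_True[OF ok(1) sYA True] show ?thesis by (simp add: s1_def)
    next
      case False
      with that Y(2) have "s z" using Z by blast
      then show ?thesis using run_other[OF ok(1) False] by (simp add: s1_def)
    qed
    then have "s2 v \<longleftrightarrow> (\<forall>c\<in>C. s1 c)" using C by (simp add: and_net_def s2_def)
    then show ?thesis using C1 by simp
  qed
  have "run (ts @ us @ [(w, v, q)]) s q = (s1 w \<and> s2 v)"
    using w2 q2 by (simp add: s1_def s2_def)
  then show "run (ts @ us @ [(w, v, q)]) s q \<longleftrightarrow> (\<forall>c\<in>A \<union> C. s c)"
    using w1 v2 by (simp only: ball_Un) blast
qed

definition has_and_net :: "nat set \<Rightarrow> nat set \<Rightarrow> nat \<Rightarrow> bool" where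
  "has_and_net Z C d \<longleftrightarrow> finite C \<and> Z \<inter> C = {} \<and> (\<exists>ts w. and_net Z C ts w \<and> fits (gadgets ts) d)"

lemma has_and_net_mono:
  assumes "has_and_net Z C d" "Z \<subseteq> Z'" "d \<le> d'" "Z' \<inter> C = {}"
  shows "has_and_net Z' C d'"
proof -
  obtain ts w where "and_net Z C ts w" "fits (gadgets ts) d" "finite C"
    using assms by (auto simp: has_and_net_def)
  moreover have "gadgets_ok (Z' \<union> C) ts" if "gadgets_ok (Z \<union> C) ts"
    using that assms(2) by (rule_tac gadgets_ok_mono) auto
  ultimately have "and_net Z' C ts w"
    using assms(2) unfolding and_net_def by (simp add: subset_iff) blast
  moreover have "fits (gadgets ts) d'" using \<open>fits (gadgets ts) d\<close> assms(3) by (rule fits_mono)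
  ultimately show ?thesis using \<open>finite C\<close> assms(4) unfolding has_and_net_def by blast
qed

lemma has_and_net_single: "c \<notin> Z \<Longrightarrow> has_and_net Z {c} d"
  unfolding has_and_net_def and_net_def by (intro conjI exI[of _ "[]"] exI[of _ c]) auto

lemma fits_gadget: "fits (gadget x) 8"
  using fits_length[of "gadget x"] by (cases x) (simp add: eval_nat_numeral)

text \<open>Absorbing \<open>A\<close> first turns its controls into ancillas for \<open>C\<close>.
  The output \<open>w\<close> of the first net is hidden in an existential, so the assumption ranges
  over all candidates.\<close>

lemma has_and_net_seq:
  assumes "has_and_net (Z - {q}) A d" "\<And>w. w \<in> (Z - {q}) \<union> A \<Longrightarrow> has_and_net ((Z - {q}) \<union> A - {w}) C e"
    and "q \<in> Z" "Z \<inter> A = {}" "Z \<inter> C = {}" "A \<inter> C = {}"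
  shows "has_and_net Z (A \<union> C) (d + e + 8)"
proof -
  obtain ts w where A: "and_net (Z - {q}) A ts w" "fits (gadgets ts) d" "finite A"
    using assms(1) by (auto simp: has_and_net_def)
  then have "w \<in> (Z - {q}) \<union> A" by (simp add: and_net_def)
  then obtain us v where C: "and_net ((Z - {q}) \<union> A - {w}) C us v" "fits (gadgets us) e" "finite C"
    using assms(2) unfolding has_and_net_def by blast
  have "and_net Z (A \<union> C) (ts @ us @ [(w, v, q)]) q"
    using assms A(3) C(3) by (intro and_net_combine[OF A(1) C(1)]) auto
  moreover have "fits (gadget (w, v, q) @ gadgets us @ gadgets ts) (8 + (e + d))"
    by (intro fits_append fits_gadget A C)
  then have "fits (gadgets (ts @ us @ [(w, v, q)])) (d + e + 8)"
    by (simp add: ac_simps del: gadget.simps)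
  ultimately show ?thesis using assms A(3) C(3) unfolding has_and_net_def by blast
qed

lemma cqubits_gadgets: "gadgets_ok Q ts \<Longrightarrow> cqubits (gadgets ts) \<subseteq> Q"
  by (induction ts) auto

text \<open>The two nets share no qubit, so they run in the same layers and only the joining gadget
  adds depth.\<close>

lemma has_and_net_par:
  assumes "has_and_net Y A d" "has_and_net Y' C d"
    and "q \<notin> Y \<union> Y' \<union> A \<union> C" "(Y \<union> A) \<inter> (Y' \<union> C) = {}"
  shows "has_and_net (insert q (Y \<union> Y')) (A \<union> C) (d + 8)"
proof -
  obtain ts w where A: "and_net Y A ts w" "fits (gadgets ts) d" "finite A" "Y \<inter> A = {}"
    using assms(1) unfolding has_and_net_def by blast
  obtain us v where C: "and_net Y' C us v" "fits (gadgets us) d" "finite C" "Y' \<inter> C = {}"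
    using assms(2) unfolding has_and_net_def by blast
  have w: "w \<in> Y \<union> A" using A by (simp add: and_net_def)
  have "Y \<subseteq> insert q (Y \<union> Y') - {q}" using assms(3) by blast
  moreover have "Y' \<subseteq> insert q (Y \<union> Y') \<union> A - {w, q}" using assms(3,4) w by blast
  moreover have "insert q (Y \<union> Y') \<inter> A = {}" "insert q (Y \<union> Y') \<inter> C = {}" "A \<inter> C = {}"
    using assms(3,4) A(4) C(4) by blast+
  ultimately have net: "and_net (insert q (Y \<union> Y')) (A \<union> C) (ts @ us @ [(w, v, q)]) q"
    and disj: "insert q (Y \<union> Y') \<inter> (A \<union> C) = {}"
    using A(3) C(3) by (blast intro: and_net_combine[OF A(1) C(1)])+
  have "cqubits (gadgets us) \<inter> cqubits (gadgets ts) = {}"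
  proof -
    have "cqubits (gadgets ts) \<subseteq> Y \<union> A" "cqubits (gadgets us) \<subseteq> Y' \<union> C"
      using A(1) C(1) cqubits_gadgets by (simp_all add: and_net_def)
    then show ?thesis using assms(4) by blast
  qed
  then have "fits (gadget (w, v, q) @ gadgets us @ gadgets ts) (8 + d)"
    by (intro fits_append fits_append_disjoint fits_gadget A C)
  then have "fits (gadgets (ts @ us @ [(w, v, q)])) (d + 8)"
    by (simp add: ac_simps del: gadget.simps)
  then show ?thesis using net disj A(3) C(3) unfolding has_and_net_def by blast
qed

text \<open>Splitting off one control uses up \<open>q\<close> and \<open>w\<close> but adds that
  control to the pool: the pool shrinks by one per step.\<close>

lemma has_and_net_chain:
  assumes "finite Z" "card C = Suc k" "k \<le> card Z" "Z \<inter> C = {}"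
  shows "has_and_net Z C (8 * k)"
  using assms
proof (induction k arbitrary: Z C)
  case 0
  then obtain c where "C = {c}" by (auto simp: card_Suc_eq)
  with 0 show ?case using has_and_net_single by auto
next
  case (Suc k)
  obtain c C' where "C = insert c C'" and C': "c \<notin> C'" "card C' = Suc k"
    using Suc.prems(2) card_Suc_eq[of C "Suc k"] by blast
  then have C: "C = {c} \<union> C'" "c \<notin> C'" "card C' = Suc k" by auto
  obtain q where q: "q \<in> Z" using Suc.prems by fastforce
  have "has_and_net (Z - {q} \<union> {c} - {w}) C' (8 * k)" if "w \<in> Z - {q} \<union> {c}" for w
  proof -
    have "card (Z - {q} \<union> {c} - {w}) = card Z - 1"
      using that q Suc.prems C by (auto simp: card_insert_if card_Diff_singleton_if)
    then show ?thesis using Suc.prems C by (intro Suc.IH) auto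
  qed
  then have "has_and_net Z ({c} \<union> C') (0 + 8 * k + 8)"
    using Suc.prems C q by (intro has_and_net_seq[of Z q] has_and_net_single) auto
  then show ?case by (simp add: C(1) ac_simps)
qed

text \<open>Three of four ancillas absorb 4 controls and leave a pool of 3 + 4 - 1 = 6; five of
  these absorb 6 more and leave 5 + 6 - 1 = 10. This provides four ancillas for each half of the
  rest and one output. The added depth per halving is 24 + 8 + 40 + 8 + 8 = 88.\<close>

lemma has_and_net_log:
  assumes "card Z = 4" "1 \<le> card C" "card C \<le> 2 ^ j" "Z \<inter> C = {}"
  shows "has_and_net Z C (88 * (j + 1))"
  using assms
proof (induction j arbitrary: Z C)
  case 0
  have "has_and_net Z C (8 * 0)"
    using 0 by (intro has_and_net_chain card_ge_0_finite) auto
  then show ?case by (rule has_and_net_mono) (use 0 in auto)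
next
  case (Suc j)
  have finZ: "finite Z" and finC: "finite C" using Suc.prems by (auto intro: card_ge_0_finite)
  show ?case
  \<comment> \<open>Up to five controls a chain on the four ancillas is enough.\<close>
  proof (cases "card C \<le> 5")
    case True
    then have "has_and_net Z C (8 * (card C - 1))"
      using Suc.prems finZ by (intro has_and_net_chain) auto
    then show ?thesis by (rule has_and_net_mono) (use True Suc.prems in auto)
  next
    case False
    obtain q where q: "q \<in> Z" using Suc.prems by fastforce
    obtain A where A: "A \<subseteq> C" "card A = 4" using obtain_subset_with_card_n[of 4 C] False by auto
    \<comment> \<open>The 56 is the chain of depth 40 on six controls, its joining gadget, and the
      gadget joining the two halves.\<close>
    have "has_and_net (Z - {q} \<union> A - {w}) (C - A) (88 * (j + 1) + 56)" if w: "w \<in> Z - {q} \<union> A" for w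
    proof -
      define Z1 where "Z1 = Z - {q} \<union> A - {w}"
      define C1 where "C1 = C - A"
      have finZ1: "finite Z1" and ZC1: "Z1 \<inter> C1 = {}" using finZ finC A Suc.prems by (auto simp: Z1_def C1_def finite_subset)
      have "card (Z - {q} \<union> A) = 7"
        using A q Suc.prems finZ finC by (subst card_Un_disjoint) (auto simp: finite_subset)
      then have Z1: "card Z1 = 6" using w finZ finC A by (simp add: Z1_def finite_subset)
      have C1: "card C1 = card C - 4" using A finC by (simp add: C1_def card_Diff_subset finite_subset)
      have "has_and_net Z1 C1 (88 * (j + 1) + 56)"
      proof (cases "card C1 \<le> 7")
        case True
        then have "has_and_net Z1 C1 (8 * (card C1 - 1))"
          using Z1 C1 False finZ1 ZC1 by (intro has_and_net_chain) auto
        then show ?thesis by (rule has_and_net_mono) (use True ZC1 in auto)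
      next
        case big: False
        obtain q' where q': "q' \<in> Z1" using Z1 by fastforce
        obtain A' where A': "A' \<subseteq> C1" "card A' = 6" using obtain_subset_with_card_n[of 6 C1] big by auto
        have finC1: "finite C1" using finC by (simp add: C1_def)
        have "has_and_net (Z1 - {q'} \<union> A' - {w'}) (C1 - A') (88 * (j + 1) + 8)" if w': "w' \<in> Z1 - {q'} \<union> A'" for w'
        proof -
          define Z2 where "Z2 = Z1 - {q'} \<union> A' - {w'}"
          define C2 where "C2 = C1 - A'"
          have finZ2: "finite Z2" and ZC2: "Z2 \<inter> C2 = {}" using finZ1 finC1 A' ZC1 by (auto simp: Z2_def C2_def finite_subset)
          have "card (Z1 - {q'} \<union> A') = 11"
            using A' q' Z1 finZ1 finC1 ZC1 by (subst card_Un_disjoint) (auto simp: finite_subset)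
          then have Z2: "card Z2 = 10" using w' finZ1 finC1 A' by (simp add: Z2_def finite_subset)
          have C2: "card C2 = card C1 - 6" using A' finC1 by (simp add: C2_def card_Diff_subset finite_subset)
          \<comment> \<open>At least eight controls were left before the second round, so at least
            two remain and both halves are nonempty.\<close>
          obtain Ca where Ca: "Ca \<subseteq> C2" "card Ca = card C2 div 2"
            using obtain_subset_with_card_n[of "card C2 div 2" C2] by auto
          define Cb where "Cb = C2 - Ca"
          have finC2: "finite C2" using finC1 by (simp add: C2_def)
          have Cb: "card Cb = card C2 - card C2 div 2"
            using Ca finC2 by (simp add: Cb_def card_Diff_subset finite_subset)
          obtain Za where Za: "Za \<subseteq> Z2" "card Za = 4" using obtain_subset_with_card_n[of 4 Z2] Z2 by auto
          have "card (Z2 - Za) = 6" using Za Z2 finZ2 by (simp add: card_Diff_subset finite_subset)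
          then obtain Zb where Zb: "Zb \<subseteq> Z2 - Za" "card Zb = 4" using obtain_subset_with_card_n[of 4 "Z2 - Za"] by auto
          have "card (Z2 - Za - Zb) = 2"
            using Za Zb \<open>card (Z2 - Za) = 6\<close> finZ2 by (simp add: card_Diff_subset finite_subset)
          then have "Z2 - Za - Zb \<noteq> {}" by (metis card.empty zero_neq_numeral)
          then obtain q'' where q'': "q'' \<in> Z2 - Za - Zb" by blast
          have "has_and_net Za Ca (88 * (j + 1))"
            using Za Ca ZC2 C2 big Suc.prems(3) C1 by (intro Suc.IH) auto
          moreover have "has_and_net Zb Cb (88 * (j + 1))"
            using Zb Cb ZC2 C2 big Suc.prems(3) C1 by (intro Suc.IH) (auto simp: Cb_def)
          ultimately have "has_and_net (insert q'' (Za \<union> Zb)) (Ca \<union> Cb) (88 * (j + 1) + 8)"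
            using Za Zb Ca ZC2 q'' by (intro has_and_net_par) (auto simp: Cb_def)
          moreover have "Ca \<union> Cb = C2" using Ca by (auto simp: Cb_def)
          ultimately have "has_and_net Z2 C2 (88 * (j + 1) + 8)"
            using Za Zb q'' ZC2 by (auto elim!: has_and_net_mono)
          then show ?thesis by (simp add: Z2_def C2_def)
        qed
        moreover have "has_and_net (Z1 - {q'}) A' (8 * 5)"
          using A' Z1 q' ZC1 finZ1 by (intro has_and_net_chain) auto
        ultimately have "has_and_net Z1 (A' \<union> (C1 - A')) (8 * 5 + (88 * (j + 1) + 8) + 8)"
          using q' ZC1 A' by (intro has_and_net_seq[of Z1 q']) auto
        moreover have "A' \<union> (C1 - A') = C1" using A' by auto
        ultimately show ?thesis by (simp add: ac_simps)
      qed
      then show ?thesis by (simp add: Z1_def C1_def)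
    qed
    moreover have "has_and_net (Z - {q}) A (8 * 3)"
      using A q Suc.prems finZ by (intro has_and_net_chain) auto
    ultimately have "has_and_net Z (A \<union> (C - A)) (8 * 3 + (88 * (j + 1) + 56) + 8)"
      using q A Suc.prems by (intro has_and_net_seq[of Z q]) auto
    moreover have "A \<union> (C - A) = C" using A by auto
    ultimately show ?thesis by (simp add: ac_simps)
  qed
qed

section \<open>The controlled tensor product\<close>

text \<open>Compute, copy the output by one CNOT, uncompute. The phase depends only on the state
  before the run, which the flip of \<open>t\<close> does not disturb, so it cancels. The condition
  is the actual output \<open>run ts s w\<close>, hence valid for dirty ancillas too.\<close>

lemma X_if_and_net:
  assumes net: "and_net Z C ts w" and Q: "Z \<union> C \<subseteq> {..<N} - {t}" and t: "t < N"
    and fits: "fits (gadgets ts) d"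
  obtains gs where "X_if N (\<lambda>s. run ts s w) (\<lambda>_. 1) [t] gs"
    "cnot_count gs \<le> 6 * card C" "fits gs (2 * d + 1)"
proof -
  let ?K = "gadgets ts"
  let ?gs = "cinv ?K @ [CNOT w t] @ ?K"
  have ok: "gadgets_ok (Z \<union> C) ts" and w: "w \<in> Z \<union> C" and len: "Suc (length ts) = card C"
    using net by (auto simp: and_net_def)
  have QN: "Z \<union> C \<subseteq> {..<N}" and tQ: "t \<notin> Z \<union> C" using Q by auto
  have wt: "w < N" "w \<noteq> t" using w QN tQ by auto
  note K = gadgets_valid[OF ok QN]
  obtain \<phi> where \<phi>: "\<And>\<chi> s. sem ?K \<chi> s = \<phi> s * \<chi> (run ts s)"
    using gadgets_monomial[OF ok] by blast
  have X: "sem ?gs \<psi> s = sem (if run ts s w then [Single t (X_mat 1)] else []) \<psi> s" for \<psi> s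
  proof -
    define \<chi> where "\<chi> = sem (cinv ?K) \<psi>"
    have K\<chi>: "sem ?K \<chi> = \<psi>" unfolding \<chi>_def using K(1) by (rule sem_cinv)
    have gs: "sem ?gs \<psi> s = \<phi> s * gate_app (CNOT w t) \<chi> (run ts s)"
      by (simp add: sem_append \<phi> \<chi>_def sem_Cons)
    show ?thesis
    proof (cases "run ts s w")
      case True
      \<comment> \<open>With the output true the CNOT reads as a bare NOT on \<open>t\<close>, which
        commutes with \<open>?K\<close> because \<open>t\<close> lies outside the net.\<close>
      have "gate_app (CNOT w t) \<chi> (run ts s) = gate_app (Single t (X_mat 1)) \<chi> (run ts s)"
        unfolding app_X_mat using True by simp
      then have "sem ?gs \<psi> s = sem ?K (gate_app (Single t (X_mat 1)) \<chi>) s"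
        unfolding gs \<phi> by simp
      also have "\<dots> = gate_app (Single t (X_mat 1)) (sem ?K \<chi>) s"
        using K(2) tQ by (subst sem_app_commute) auto
      finally show ?thesis using True unfolding K\<chi> by (simp del: gate_app.simps)
    next
      case False
      then have "sem ?gs \<psi> s = sem ?K \<chi> s" unfolding gs \<phi> by simp
      with False show ?thesis unfolding K\<chi> by simp
    qed
  qed
  have "eqv (set [t]) s ?gs (layer (\<lambda>t. if run ts s w then X_mat 1 else 1\<^sub>m 2) [t])" for s
    unfolding eqv_def
  proof (intro allI impI)
    fix \<psi> s' assume s': "agree_off (set [t]) s s'"
    have "run ts s' w = run ts s w"
      by (rule run_cong[OF ok _ w]) (use s' tQ in \<open>auto simp: agree_off_def\<close>)
    then show "sem ?gs \<psi> s' = sem (layer (\<lambda>t. if run ts s w then X_mat 1 else 1\<^sub>m 2) [t]) \<psi> s'"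
      unfolding X by (simp del: gate_app.simps)
  qed
  moreover have "valid_circuit N ?gs" using K(1) wt t by simp
  ultimately have "X_if N (\<lambda>s. run ts s w) (\<lambda>_. 1) [t] ?gs" by (simp add: X_if_def)
  moreover have "cnot_count ?gs \<le> 6 * card C" using K(3) len by simp
  moreover have "fits ?gs (d + (1 + d))"
    using fits fits_length[of "[CNOT w t]"] by (intro fits_append fits_cinv) auto
  then have "fits ?gs (2 * d + 1)" by (rule fits_mono) simp
  ultimately show ?thesis by (rule that)
qed

section \<open>From slices to the matrix of the controlled gate\<close>

lemma sem_layer_basis:
  assumes "distinct ts"
  shows "sem (layer f ts) (\<lambda>s. of_bool (s = x)) s
    = (if \<forall>q. q \<notin> set ts \<longrightarrow> s q = x q then \<Prod>t\<in>set ts. f t $$ (of_bool (s t), of_bool (x t)) else 0)"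
  using assms
proof (induction ts arbitrary: s)
  case Nil
  then show ?case by (auto simp: fun_eq_iff)
next
  case (Cons t ts)
  let ?P = "\<lambda>s. \<Prod>u\<in>set ts. f u $$ (of_bool (s u), of_bool (x u))"
  have prod: "?P (s(t := b)) = ?P s" for b
    using Cons.prems by (intro prod.cong) auto
  have cond: "(\<forall>q. q \<notin> set ts \<longrightarrow> (s(t := b)) q = x q) \<longleftrightarrow> b = x t \<and> (\<forall>q. q \<notin> set (t # ts) \<longrightarrow> s q = x q)" for b
    using Cons.prems by auto
  have IH: "sem (layer f ts) (\<lambda>s. of_bool (s = x)) (s(t := b))
      = (if b = x t \<and> (\<forall>q. q \<notin> set (t # ts) \<longrightarrow> s q = x q) then ?P s else 0)" for b
  proof -
    have "distinct ts" using Cons.prems by simp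
    from Cons.IH[OF this, of "s(t := b)"] show ?thesis unfolding prod cond .
  qed
  have "sem (layer f (t # ts)) (\<lambda>s. of_bool (s = x)) s
      = gate_app (Single t (f t)) (sem (layer f ts) (\<lambda>s. of_bool (s = x))) s"
    using Cons.prems by (simp add: sem_Cons sem_app_commute del: gate_app.simps)
  then show ?case
    unfolding gate_app.simps IH using Cons.prems by (cases "x t") auto
qed

text \<open>The slice description tests the controls of the row \<open>i\<close>, the target matrix
  those of the column \<open>j\<close>. They agree because a layer on the targets has zero entries
  between states with different controls.\<close>

lemma circuit_mat_controlled_tensor:
  assumes valid: "valid_circuit (n + m) gs"
    and eqv: "\<And>s. eqv (set [n..<n + m]) s gs
      (layer (\<lambda>t. if \<forall>q<n. s q then W (t - n) else 1\<^sub>m 2) [n..<n + m])"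
  shows "circuit_mat (n + m) gs = controlled_tensor_mat n m W"
proof (rule eq_matI)
  fix i j assume "i < dim_row (controlled_tensor_mat n m W)" "j < dim_col (controlled_tensor_mat n m W)"
  then have ij: "i < 2 ^ (n + m)" "j < 2 ^ (n + m)" by (simp_all add: controlled_tensor_mat_def)
  let ?d = "\<lambda>s. of_bool (s = bit j) :: complex"
  have sem: "circuit_mat (n + m) gs $$ (i, j)
      = sem (layer (\<lambda>t. if \<forall>q<n. bit i q then W (t - n) else 1\<^sub>m 2) [n..<n + m]) ?d (bit i)"
    using circuit_mat_index[OF valid ij] eqv[of "bit i"] by (simp add: eqv_def)
  have high: "\<not> bit i q" "\<not> bit j q" if "q \<ge> n + m" for q
    using that ij bit_below_power[of i "n + m" q] bit_below_power[of j "n + m" q] by auto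
  show "circuit_mat (n + m) gs $$ (i, j) = controlled_tensor_mat n m W $$ (i, j)"
  proof (cases "\<forall>q<n. bit i q")
    case True
    have low: "(\<forall>q. q \<notin> set [n..<n + m] \<longrightarrow> bit i q = bit j q) \<longleftrightarrow> (\<forall>q<n. bit j q)"
    proof
      assume "\<forall>q. q \<notin> set [n..<n + m] \<longrightarrow> bit i q = bit j q"
      with True show "\<forall>q<n. bit j q" by auto
    next
      assume j: "\<forall>q<n. bit j q"
      show "\<forall>q. q \<notin> set [n..<n + m] \<longrightarrow> bit i q = bit j q"
      proof (intro allI impI)
        fix q assume "q \<notin> set [n..<n + m]"
        then have "q < n \<or> q \<ge> n + m" by auto
        then show "bit i q = bit j q" using True j high by auto
      qed
    qed
    have "circuit_mat (n + m) gs $$ (i, j)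
      = (if \<forall>q<n. bit j q then \<Prod>t\<in>set [n..<n + m]. W (t - n) $$ (of_bool (bit i t), of_bool (bit j t)) else 0)"
      unfolding sem if_P[OF True] sem_layer_basis[OF distinct_upt] low ..
    also have "(\<Prod>t\<in>set [n..<n + m]. W (t - n) $$ (of_bool (bit i t), of_bool (bit j t)))
        = (\<Prod>k<m. W k $$ (of_bool (bit i (n + k)), of_bool (bit j (n + k))))"
      by (rule prod.reindex_bij_witness[of _ "\<lambda>k. n + k" "\<lambda>t. t - n"]) auto
    finally show ?thesis using True ij by (auto simp: controlled_tensor_mat_def)
  next
    case False
    then have "circuit_mat (n + m) gs $$ (i, j) = of_bool (i = j)"
      unfolding sem if_not_P[OF False] by (subst sem_layer_one) (simp_all add: bit_eq_fun_iff)
    with False ij show ?thesis by (auto simp: controlled_tensor_mat_def)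
  qed
qed (use carrier_matD[OF circuit_mat_carrier] in \<open>simp_all add: controlled_tensor_mat_def\<close>)

lemma log_exponent:
  assumes "n \<ge> 1"
  obtains j where "n \<le> 2 ^ j" "real j \<le> 1 + log 2 (real n)"
proof -
  let ?j = "nat \<lceil>log 2 (real n)\<rceil>"
  have nn: "0 \<le> log 2 (real n)" using assms by simp
  have "log 2 (real n) \<le> real ?j" by linarith
  then have "real n \<le> 2 powr real ?j" using assms by (simp add: le_powr_iff log_le_iff)
  then have "real n \<le> real (2 ^ ?j)" by (simp add: powr_realpow)
  then have "n \<le> 2 ^ ?j" by (simp only: of_nat_le_iff)
  moreover have "real ?j \<le> 1 + log 2 (real n)" using nn by linarith
  ultimately show ?thesis by (rule that)
qed

text \<open>The first \<open>min n 4\<close> controls act as ancillas, so \<open>F\<close> is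
  prescribed only where they are all 1; elsewhere the other factor of the commutator is false. For
  \<open>n\<close> at most 4 no control remains and an unconditional NOT suffices. The depth is
  \<open>2 * (88 * (j + 1)) + 1\<close>.\<close>

lemma conditional_and_gate:
  assumes "1 \<le> n" "n \<le> t" "t < N" "n \<le> 2 ^ j"
  obtains gs F where "X_if N F (\<lambda>_. 1) [t] gs" "cnot_count gs \<le> 6 * (n - min n 4)" "fits gs (176 * j + 177)"
    "\<And>s s'. (\<And>q. q < n \<Longrightarrow> s q = s' q) \<Longrightarrow> F s = F s'"
    "\<And>s. (\<And>q. q < min n 4 \<Longrightarrow> s q) \<Longrightarrow> F s \<longleftrightarrow> (\<forall>q<n. s q)"
proof (cases "n \<le> 4")
  case True
  have "fits [Single t (X_mat 1)] (176 * j + 177)"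
    using fits_length[of "[Single t (X_mat 1)]"] by (rule fits_mono) simp
  moreover have "min n 4 = n" using True by simp
  ultimately show ?thesis
    by (intro that[OF X_if_True[OF assms(3)]]) simp_all
next
  case False
  have "has_and_net {..<4} {4..<n} (88 * (j + 1))"
    using False assms by (intro has_and_net_log) auto
  then obtain ts w where net: "and_net {..<4} {4..<n} ts w" and fits: "fits (gadgets ts) (88 * (j + 1))"
    unfolding has_and_net_def by blast
  have Q: "{..<4} \<union> {4..<n} = {..<n}" using False by (intro ivl_disj_un_one) simp
  have "{..<4} \<union> {4..<n} \<subseteq> {..<N} - {t}" unfolding Q using assms by auto
  from X_if_and_net[OF net this assms(3) fits] obtain gs where gs: "X_if N (\<lambda>s. run ts s w) (\<lambda>_. 1) [t] gs"
    "cnot_count gs \<le> 6 * card {4..<n}" "fits gs (2 * (88 * (j + 1)) + 1)" .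
  have ok: "gadgets_ok {..<n} ts" "w \<in> {..<n}"
    using and_netD(1,2)[OF net] unfolding Q .
  note run = and_netD(3)[OF net]
  show ?thesis
  proof (rule that[OF gs(1)])
    show "cnot_count gs \<le> 6 * (n - min n 4)" using gs(2) False by simp
    show "fits gs (176 * j + 177)" using gs(3) by (rule fits_mono) simp
    show "run ts s w = run ts s' w" if "\<And>q. q < n \<Longrightarrow> s q = s' q" for s s'
      by (rule run_cong[OF ok(1) _ ok(2)]) (use that in simp)
    show "run ts s w \<longleftrightarrow> (\<forall>q<n. s q)" if "\<And>q. q < min n 4 \<Longrightarrow> s q" for s
    proof -
      have 4: "s q" if "q < 4" for q
        using \<open>q < 4\<close> False by (intro \<open>\<And>q. q < min n 4 \<Longrightarrow> s q\<close>) simp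
      then have "run ts s w = (\<forall>c\<in>{4..<n}. s c)" by (intro run) blast
      also have "(\<forall>c\<in>{4..<n}. s c) = (\<forall>q<n. s q)"
      proof (intro iffI allI impI ballI)
        fix q assume "\<forall>c\<in>{4..<n}. s c" "q < n"
        then show "s q" using 4[of q] by (cases "q < 4") simp_all
      qed simp
      finally show ?thesis .
    qed
  qed
qed

lemma controlled_tensor_circuit:
  assumes n: "n \<ge> 1" and m: "m \<ge> 1" and W: "\<forall>k<m. W k \<in> SU2" and i: "n \<le> 2 ^ i" and j: "m \<le> 2 ^ j"
  obtains gs where "valid_circuit (n + m) gs" "circuit_mat (n + m) gs = controlled_tensor_mat n m W"
    "cnot_count gs + 16 \<le> 12 * n + 8 * m" "fits gs (352 * i + 8 * j + 452)"
proof -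
  let ?N = "n + m" and ?us = "[Suc n..<n + m]"
  have us: "[n..<n + m] = n # ?us" using m by (simp add: upt_conv_Cons)
  have nN: "n < ?N" using m by simp
  have dist: "distinct (n # ?us)" and bound: "\<And>u. u \<in> set (n # ?us) \<Longrightarrow> u < ?N" and len: "length (n # ?us) \<le> 2 ^ j"
    using m j unfolding us[symmetric] by auto
  have set_us: "set (n # ?us) = {n..<n + m}" unfolding us[symmetric] by simp
  obtain A F where A: "X_if ?N F (\<lambda>_. 1) [n] A" "cnot_count A \<le> 6 * (n - min n 4)" "fits A (176 * i + 177)"
    and F: "\<And>s s'. (\<And>q. q < n \<Longrightarrow> s q = s' q) \<Longrightarrow> F s = F s'"
      "\<And>s. (\<And>q. q < min n 4 \<Longrightarrow> s q) \<Longrightarrow> F s \<longleftrightarrow> (\<forall>q<n. s q)"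
  proof (rule conditional_and_gate[OF n order_refl nN i], goal_cases)
    case (1 A F)
    show ?case by (rule 1(1)[OF 1(2-6)])
  qed
  define G where "G = (\<lambda>s :: nat \<Rightarrow> bool. \<forall>c\<in>{..<min n 4}. s c)"
  have S: "1 \<le> card {..<min n 4}" "card {..<min n 4} \<le> 4" "{..<min n 4} \<subseteq> {..<?N} - {n}"
    using n by auto
  from and_gate_exists[OF S nN] obtain B l where B: "X_if ?N G l [n] B" "cnot_count B + 4 \<le> 6 * min n 4" "fits B 46"
    unfolding G_def card_lessThan .
  have Fi: "F s' = F s" if "agree_off (set (n # ?us)) s s'" for s s'
    using that unfolding set_us agree_off_def by (intro F(1)) auto
  have Gi: "G s' = G s" if "agree_off (set (n # ?us)) s s'" for s s'
    using that unfolding set_us agree_off_def G_def by auto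
  obtain A' k where A': "X_if ?N F k (n # ?us) A'" "cnot_count A' = cnot_count A + 2 * length ?us"
    "fits A' (176 * i + 177 + 2 * j)"
    by (rule X_if_fan_out[OF A(1) dist bound Fi A(3) len]) auto
  obtain B' k' where B': "X_if ?N G k' (n # ?us) B'" "cnot_count B' = cnot_count B + 2 * length ?us"
    "fits B' (46 + 2 * j)"
    by (rule X_if_fan_out[OF B(1) dist bound Gi B(3) len]) auto
  have W': "W (t - n) \<in> SU2" if "t \<in> set (n # ?us)" for t
    using that W unfolding set_us by auto
  obtain gs where gs: "valid_circuit ?N gs"
    "\<And>s. eqv (set (n # ?us)) s gs (layer (\<lambda>t. if F s \<and> G s then W (t - n) else 1\<^sub>m 2) (n # ?us))"
    "cnot_count gs = 2 * (cnot_count A' + cnot_count B')"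
    "fits gs (6 + 2 * (176 * i + 177 + 2 * j + (46 + 2 * j)))"
    by (rule commutator_circuit[OF dist bound W' A'(1) B'(1) A'(3) B'(3)]) auto
  \<comment> \<open>\<open>G\<close> asserts exactly the cleanness under which \<open>F\<close> is
    the full conjunction.\<close>
  have FG: "F s \<and> G s \<longleftrightarrow> (\<forall>q<n. s q)" for s
    using F(2)[of s] by (auto simp: G_def)
  show ?thesis
  proof (rule that[OF gs(1)])
    show "circuit_mat ?N gs = controlled_tensor_mat n m W"
      using gs(1,2) unfolding FG us[symmetric] by (rule circuit_mat_controlled_tensor)
    \<comment> \<open>With \<open>?us\<close> of length \<open>m - 1\<close> the total is at most
      \<open>2 * (6 * n - 4 + 4 * (m - 1))\<close>.\<close>
    show "cnot_count gs + 16 \<le> 12 * n + 8 * m"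
      using gs(3) A'(2) B'(2) A(2) B(2) m by auto
    show "fits gs (352 * i + 8 * j + 452)"
      using gs(4) by (rule fits_mono) simp
  qed
qed

theorem theorem3:
  shows "\<exists>C::real. \<forall>(n::nat) (m::nat) (W :: nat \<Rightarrow> complex mat).
    n \<ge> 1 \<longrightarrow> m \<ge> 1 \<longrightarrow> (\<forall>k<m. W k \<in> SU2) \<longrightarrow>
    (\<exists>gs. valid_circuit (n + m) gs \<and>
          circuit_mat (n + m) gs = controlled_tensor_mat n m W \<and>
          int (cnot_count gs) \<le> 12 * int n + 8 * int m - 14 \<and>
          real (circuit_depth gs) \<le> C * (1 + log 2 (real n) + log 2 (real m)))"
proof (intro exI[of _ 812] allI impI)
  fix n m :: nat and W :: "nat \<Rightarrow> complex mat"
  assume n: "n \<ge> 1" and m: "m \<ge> 1" and W: "\<forall>k<m. W k \<in> SU2"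
  obtain i where i: "n \<le> 2 ^ i" "real i \<le> 1 + log 2 (real n)" using log_exponent[OF n] .
  obtain j where j: "m \<le> 2 ^ j" "real j \<le> 1 + log 2 (real m)" using log_exponent[OF m] .
  obtain gs where gs: "valid_circuit (n + m) gs" "circuit_mat (n + m) gs = controlled_tensor_mat n m W"
    "cnot_count gs + 16 \<le> 12 * n + 8 * m" "fits gs (352 * i + 8 * j + 452)"
    using controlled_tensor_circuit[OF n m W i(1) j(1)] .
  have "real (circuit_depth gs) \<le> real (352 * i + 8 * j + 452)"
    using circuit_depth_le[OF gs(4)] by (simp only: of_nat_le_iff)
  also have "\<dots> = 352 * real i + 8 * real j + 452" by simp
  \<comment> \<open>Rounding both exponents up costs 352 and 8, which with 452 gives the constant
    812.\<close>
  also have "\<dots> \<le> 812 * (1 + log 2 (real n) + log 2 (real m))"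
  proof -
    have "0 \<le> log 2 (real n)" "0 \<le> log 2 (real m)" using n m by simp_all
    then show ?thesis using i(2) j(2) by (simp add: algebra_simps)
  qed
  finally show "\<exists>gs. valid_circuit (n + m) gs \<and>
      circuit_mat (n + m) gs = controlled_tensor_mat n m W \<and>
      int (cnot_count gs) \<le> 12 * int n + 8 * int m - 14 \<and>
      real (circuit_depth gs) \<le> 812 * (1 + log 2 (real n) + log 2 (real m))"
    using gs by (intro exI[of _ gs] conjI) auto
qed

end
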